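(* Let $F$ be a number field with ring of integers $\mathcal{O}_F$, let $b,t\in\mathcal{O}_F$, and suppose that the polynomial $x^3+bx+b^2t$ is irreducible over $F$. Let $r$ be a root of this polynomial and let $d=-27bt^2-4$. Then $F(r,\sqrt{bd})$ is an unramified extension of $F(\sqrt{bd})$.
   Context: Unramified means unramified at all places, finite and infinite. *)

theory Defs
  imports
    Complex_Main
    "HOL-Computational_Algebra.Polynomial"
    "HOL-Algebra.Ideal_Product"
    "HOL-Algebra.Generated_Fields"
    "HOL-Algebra.Embedded_Algebras"
    "HOL-Algebra.Polynomial_Divisibility"
    "HOL-Algebra.Algebraic_Closure_Type"
begin

text \<open>
  All fields are subfields of an arbitrary ambient field of characteristic zero, given as a type
  \<open>'a\<close>. The record below is the ambient field (or, at another type, the target of an embedding)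
  as an object of the structural algebra library.
\<close>

abbreviation ambient :: "'a::field_char_0 ring" where
  "ambient \<equiv> ring_of_type_algebra"

definition number_field :: "'a::field_char_0 set \<Rightarrow> bool" where
  "number_field K \<longleftrightarrow> subfield K ambient \<and> ring.finite_dimension ambient \<rat> K"

definition ring_of_integers :: "'a::field_char_0 set \<Rightarrow> 'a set" where
  "ring_of_integers K = {x \<in> K. algebraic_int x}"

definition integer_ring :: "'a::field_char_0 set \<Rightarrow> 'a ring" where
  "integer_ring K = ambient\<lparr>carrier := ring_of_integers K\<rparr>"

definition adjoin :: "'a::field_char_0 set \<Rightarrow> 'a set \<Rightarrow> 'a set" where
  "adjoin K S = generate_field ambient (K \<union> S)"

text \<open>
  For a nonzero prime \<open>P\<close> of the integers of \<open>M\<close>, lying over \<open>P \<inter> K\<close>, the exponent of \<open>P\<close> in the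
  factorisation of the extended ideal. In a Dedekind domain an ideal is divisible by
  \<open>P\<^sup>n\<close> iff it is contained in \<open>P\<^sup>n\<close>.
\<close>

definition ramification_index :: "'a::field_char_0 set \<Rightarrow> 'a set \<Rightarrow> 'a set \<Rightarrow> nat" where
  "ramification_index K M P =
     (GREATEST n::nat. Idl\<^bsub>integer_ring M\<^esub> (P \<inter> ring_of_integers K)
                         \<subseteq> P [^]\<^bsub>ideals_set (integer_ring M)\<^esub> n)"

text \<open>Residue extensions are extensions of finite fields, so separability is automatic.\<close>

definition unramified_at_finite_places :: "'a::field_char_0 set \<Rightarrow> 'a set \<Rightarrow> bool" where
  "unramified_at_finite_places K M \<longleftrightarrow>
     (\<forall>P. primeideal P (integer_ring M) \<and> P \<noteq> {0} \<longrightarrow> ramification_index K M P = 1)"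

text \<open>
  An infinite place is a conjugacy class of complex embeddings. It is real if
  the image of the embedding is real, and complex otherwise; this does not depend on the
  representative. The place of \<open>K\<close> below the class of \<open>\<tau>\<close> is the class of the restriction
  of \<open>\<tau>\<close> to \<open>K\<close>.
\<close>

definition complex_embeddings :: "'a::field_char_0 set \<Rightarrow> ('a \<Rightarrow> complex) set" where
  "complex_embeddings K = ring_hom (ambient\<lparr>carrier := K\<rparr>) (ambient :: complex ring)"

definition real_on :: "'a set \<Rightarrow> ('a \<Rightarrow> complex) \<Rightarrow> bool" where
  "real_on K \<tau> \<longleftrightarrow> \<tau> ` K \<subseteq> \<real>"

text \<open>A place is ramified if it is complex and the place below it is real.\<close>

definition unramified_at_infinite_places :: "'a::field_char_0 set \<Rightarrow> 'a set \<Rightarrow> bool" where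
  "unramified_at_infinite_places K M \<longleftrightarrow>
     (\<forall>\<tau> \<in> complex_embeddings M. \<not> (real_on K \<tau> \<and> \<not> real_on M \<tau>))"

definition unramified_extension :: "'a::field_char_0 set \<Rightarrow> 'a set \<Rightarrow> bool" where
  "unramified_extension K M \<longleftrightarrow>
     number_field K \<and> number_field M \<and> K \<subseteq> M \<and>
     unramified_at_finite_places K M \<and> unramified_at_infinite_places K M"

text \<open>
  Library polynomials over a subfield are coefficient lists, leading coefficient first.
\<close>

definition irreducible_over :: "'a::field_char_0 set \<Rightarrow> 'a list \<Rightarrow> bool" where
  "irreducible_over K p \<longleftrightarrow> p \<in> carrier (K[X]\<^bsub>ambient\<^esub>) \<and> pirreducible\<^bsub>ambient\<^esub> K p"

end

theory Submission
  imports Defs "Jordan_Normal_Form.Char_Poly"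
begin

text \<open>
  Let \<open>K = F(s)\<close> and \<open>M = K(r)\<close>. The cubic \<open>x\<^sup>3 + b * x + b\<^sup>2 * t\<close> has
  discriminant \<open>b\<^sup>3 * d = (b * s)\<^sup>2\<close>, a square in \<open>K\<close>, and it has no root in
  \<open>K\<close>. So \<open>M\<close> is cyclic of degree 3 over \<open>K\<close>, with a generator \<open>\<sigma>\<close> of the Galois
  group that permutes the roots cyclically.

  Infinite places: at a real place of \<open>K\<close> the discriminant of the cubic is the square of a real
  number, so its roots are real (\<open>real_cubic_roots\<close>).

  Finite places: let \<open>P\<close> be a nonzero prime of \<open>M\<close>. The inertia group at \<open>P\<close> is trivial
  as soon as some integer \<open>y\<close> of \<open>M\<close> has conjugates that are not all congruent modulo \<open>P\<close>,
  since the group has prime order. If \<open>y\<close> is a root of \<open>x\<^sup>3 + u * x + v\<close> with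
  \<open>u\<close> not in \<open>P\<close>, then this is the case, whatever the residue characteristic. For \<open>b\<close> not in
  \<open>P\<close> the root \<open>r\<close> itself is such a \<open>y\<close>. For \<open>b\<close> in \<open>P\<close> put
  \<open>w = (b * t - s) / 2\<close> and \<open>u = t * w - (1 + 7 * b * t\<^sup>2)\<close>. Then
  \<open>w\<^sup>2 = b * u\<close>, so \<open>w\<close> is an integer of \<open>K\<close> that lies in \<open>P\<close>, and \<open>u\<close>
  is congruent to \<open>- 1\<close>. The element \<open>y = w * r / b\<close> is a root of
  \<open>x\<^sup>3 + u * x + t * w * u\<close>, hence it is integral and serves.

  The passage from trivial inertia to ramification index 1 does not use the factorisation of ideals
  (\<open>trace_notin_square_P\<close>). Choose \<open>\<pi>\<close> in \<open>P\<close> but not in \<open>P\<^sup>2\<close>, with all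
  its conjugates in \<open>P\<close>. The traces of the multiples of \<open>\<pi>\<close> lie in the prime of \<open>K\<close>
  below \<open>P\<close>. By Artin's independence of characters, one of them is not in \<open>P\<^sup>2\<close>, so
  \<open>P\<^sup>2\<close> does not contain the prime below. That \<open>P\<close> differs from \<open>P\<^sup>2\<close> follows
  from Nakayama's lemma, because \<open>P\<close> is finitely generated.
\<close>

section \<open>Integral closedness of the algebraic integers\<close>

text \<open>The field as a module over the integers and as a vector space over the rationals, so that
  the spans and the dimension bounds of the abstract theory become available.\<close>

interpretation int_span: Modules.module "\<lambda>(k::int) (x::'a::field_char_0). of_int k * x"
  by unfold_locales (auto simp: algebra_simps)

interpretation rat_span: vector_space "\<lambda>(q::rat) (x::'a::field_char_0). of_rat q * x"
  by unfold_locales (auto simp: algebra_simps of_rat_add of_rat_mult)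

text \<open>If multiplication by \<open>x\<close> preserves a finitely generated subgroup that is not zero, then
  \<open>x\<close> is an eigenvalue of an integer matrix, hence a root of its characteristic polynomial.\<close>

lemma algebraic_int_if_stable:
  fixes x :: "'a::field_char_0"
  assumes fin: "finite S" and v: "v \<in> S" "v \<noteq> 0"
    and stable: "\<And>w. w \<in> S \<Longrightarrow> x * w \<in> int_span.span S"
  shows "algebraic_int x"
proof -
  obtain ws where ws: "set ws = S" "distinct ws"
    using finite_distinct_list[OF fin] by blast
  define n where "n = length ws"
  have "\<exists>a. \<forall>w\<in>S. x * w = (\<Sum>u\<in>S. of_int (a w u) * u)"
  proof -
    have "\<forall>w\<in>S. \<exists>c. x * w = (\<Sum>u\<in>S. of_int (c u) * u)"
      using stable unfolding int_span.span_finite[OF fin] by blast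
    then show ?thesis by metis
  qed
  then obtain a where a: "\<And>w. w \<in> S \<Longrightarrow> x * w = (\<Sum>u\<in>S. of_int (a w u) * u)" by blast
  define A where "A = mat n n (\<lambda>(i, j). a (ws ! i) (ws ! j))"
  have A: "A \<in> carrier_mat n n" by (simp add: A_def)
  define B where "B = map_mat (of_int :: int \<Rightarrow> 'a) A"
  have B: "B \<in> carrier_mat n n" using A by (simp add: B_def)
  define z where "z = vec n (\<lambda>i. ws ! i)"
  have "B *\<^sub>v z = x \<cdot>\<^sub>v z"
  proof (rule eq_vecI)
    fix i assume i: "i < dim_vec (x \<cdot>\<^sub>v z)"
    then have i: "i < n" by (simp add: z_def)
    then have "ws ! i \<in> S" using ws n_def by auto
    then have "x * ws ! i = (\<Sum>u\<in>S. of_int (a (ws ! i) u) * u)" by (rule a)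
    also have "\<dots> = (\<Sum>j<n. of_int (a (ws ! i) (ws ! j)) * ws ! j)"
      using sum.reindex_bij_betw[OF bij_betw_nth[OF ws(2) refl, of S], of "\<lambda>u. of_int (a (ws ! i) u) * u"]
        ws(1) by (simp add: n_def)
    finally show "(B *\<^sub>v z) $ i = (x \<cdot>\<^sub>v z) $ i"
      using i by (simp add: B_def A_def z_def scalar_prod_def atLeast0LessThan)
  qed (simp add: B_def A_def z_def)
  moreover have "z \<noteq> 0\<^sub>v n"
  proof
    assume "z = 0\<^sub>v n"
    moreover obtain i where "i < n" "ws ! i = v"
      using v ws by (metis in_set_conv_nth n_def)
    ultimately show False using v by (metis index_vec index_zero_vec(1) z_def)
  qed
  ultimately have "eigenvector B z x"
    using B by (simp add: eigenvector_def z_def)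
  then have "poly (char_poly B) x = 0"
    using eigenvalue_root_char_poly[OF B] eigenvalue_def by blast
  moreover have "char_poly B = map_poly of_int (char_poly A)"
    unfolding B_def by (rule of_int_hom.char_poly_hom[OF A])
  moreover have "lead_coeff (char_poly A) = 1"
    using degree_monic_char_poly[OF A] by simp
  ultimately show ?thesis
    unfolding algebraic_int_altdef_ipoly by metis
qed

text \<open>If \<open>x\<close> satisfies a monic equation of degree \<open>n\<close> whose coefficients preserve the span of
  \<open>S\<close>, then \<open>x\<close> preserves the span of all \<open>v * x ^ i\<close> with \<open>v \<in> S\<close> and
  \<open>i < n\<close>, and so does everything that already preserved the span of \<open>S\<close>.\<close>

lemma int_span_adjoin:
  fixes x :: "'a::field_char_0"
  assumes fin: "finite S"
    and root: "x ^ n = (\<Sum>i<n. c i * x ^ i)"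
    and coeffs: "\<And>i v. i < n \<Longrightarrow> v \<in> S \<Longrightarrow> c i * v \<in> int_span.span S"
  defines "T \<equiv> (\<lambda>(v, i). v * x ^ i) ` (S \<times> {..<n})"
  shows "\<And>z w. (\<And>v. v \<in> S \<Longrightarrow> z * v \<in> int_span.span S) \<Longrightarrow> w \<in> T \<Longrightarrow> z * w \<in> int_span.span T"
    and "\<And>w. w \<in> T \<Longrightarrow> x * w \<in> int_span.span T"
proof -
  have lift: "u * x ^ i \<in> int_span.span T" if "u \<in> int_span.span S" "i < n" for u i
    using that(1)
  proof (induction rule: int_span.span_induct_alt)
    case base
    then show ?case by (simp add: int_span.span_zero)
  next
    case (step k v y)
    have "v * x ^ i \<in> T" using step that(2) by (force simp: T_def)
    then have "of_int k * (v * x ^ i) + y * x ^ i \<in> int_span.span T"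
      using step by (intro int_span.span_add int_span.span_scale) (auto intro: int_span.span_base)
    then show ?case by (simp add: algebra_simps)
  qed
  show "z * w \<in> int_span.span T"
    if z: "\<And>v. v \<in> S \<Longrightarrow> z * v \<in> int_span.span S" and w: "w \<in> T" for z w
  proof -
    obtain v i where "v \<in> S" "i < n" "w = v * x ^ i" using w by (auto simp: T_def)
    then show ?thesis using lift[OF z[of v], of i] by (simp add: mult.assoc)
  qed
  show "x * w \<in> int_span.span T" if w: "w \<in> T" for w
  proof -
    obtain v i where vi: "v \<in> S" "i < n" "w = v * x ^ i" using w by (auto simp: T_def)
    show ?thesis
    proof (cases "Suc i < n")
      case True
      have "v * x ^ Suc i \<in> int_span.span T"
        using lift[OF int_span.span_base[OF vi(1)] True] .
      then show ?thesis by (simp add: vi algebra_simps)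
    next
      case False
      then have "n = Suc i" using vi by simp
      then have "x * w = v * x ^ n" by (simp add: vi algebra_simps)
      also have "\<dots> = (\<Sum>j<n. (c j * v) * x ^ j)"
        by (simp add: root sum_distrib_left algebra_simps)
      also have "\<dots> \<in> int_span.span T"
        using lift coeffs[OF _ vi(1)] by (intro int_span.span_sum) auto
      finally show ?thesis .
    qed
  qed
qed

text \<open>Finitely many algebraic integers preserve the span of one common finite set, obtained by
  adjoining their powers one element at a time.\<close>

lemma ex_stable_set:
  fixes C :: "'a::field_char_0 set"
  assumes "finite C" "\<And>c. c \<in> C \<Longrightarrow> algebraic_int c"
  shows "\<exists>S. finite S \<and> 1 \<in> S \<and> (\<forall>c\<in>C. \<forall>v\<in>S. c * v \<in> int_span.span S)"
  using assms
proof (induction rule: finite_induct)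
  case empty
  show ?case by (intro exI[of _ "{1}"]) auto
next
  case (insert x C)
  then obtain S where S: "finite S" "1 \<in> S" "\<And>c v. c \<in> C \<Longrightarrow> v \<in> S \<Longrightarrow> c * v \<in> int_span.span S"
    by auto
  obtain p where p: "poly (map_poly of_int p) x = 0" "lead_coeff p = 1"
    using insert.prems algebraic_int_altdef_ipoly by blast
  define n where "n = Polynomial.degree p"
  define c where "c i = (of_int (- Polynomial.coeff p i) :: 'a)" for i
  have "n \<noteq> 0"
  proof
    assume "n = 0"
    then have "p = [:1:]" using p(2) degree_0_id[of p] n_def by simp
    then show False using p(1) by simp
  qed
  have "0 = (\<Sum>i\<le>n. of_int (Polynomial.coeff p i) * x ^ i)"
    using p(1) by (simp add: poly_altdef n_def)
  also have "\<dots> = x ^ n + (\<Sum>i<n. of_int (Polynomial.coeff p i) * x ^ i)"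
    using p(2) by (simp add: lessThan_Suc_atMost[symmetric] n_def)
  finally have root: "x ^ n = (\<Sum>i<n. c i * x ^ i)"
    by (simp add: c_def sum_negf eq_neg_iff_add_eq_0)
  have coeffs: "c i * v \<in> int_span.span S" if "v \<in> S" for i v
    unfolding c_def using that by (intro int_span.span_scale int_span.span_base)
  define T where "T = (\<lambda>(v, i). v * x ^ i) ` (S \<times> {..<n})"
  note ad = int_span_adjoin[where S = S and x = x and n = n and c = c, OF S(1) root coeffs, folded T_def]
  have "finite T" by (simp add: T_def S)
  moreover have "1 \<in> T" using S \<open>n \<noteq> 0\<close> by (force simp: T_def)
  moreover have "\<forall>y\<in>insert x C. \<forall>v\<in>T. y * v \<in> int_span.span T"
    using ad S(3) by auto
  ultimately show ?case by blast
qed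

text \<open>The algebraic integers are integrally closed.\<close>

lemma algebraic_int_monic_root:
  fixes x :: "'a::field_char_0"
  assumes root: "x ^ n = (\<Sum>i<n. c i * x ^ i)"
    and c: "\<And>i. i < n \<Longrightarrow> algebraic_int (c i)"
  shows "algebraic_int x"
proof -
  obtain S where S: "finite S" "1 \<in> S" "\<forall>y\<in>c ` {..<n}. \<forall>v\<in>S. y * v \<in> int_span.span S"
    using ex_stable_set[of "c ` {..<n}"] c by auto
  have "n \<noteq> 0" using root by (cases n) auto
  define T where "T = (\<lambda>(v, i). v * x ^ i) ` (S \<times> {..<n})"
  have "finite T" "1 \<in> T" using S \<open>n \<noteq> 0\<close> by (force simp: T_def)+
  moreover have "x * w \<in> int_span.span T" if "w \<in> T" for w
    using int_span_adjoin(2)[where S = S and x = x and n = n and c = c, OF S(1) root] S(3) that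
    by (auto simp: T_def)
  ultimately show ?thesis by (intro algebraic_int_if_stable) auto
qed

lemma algebraic_int_depressed_cubic:
  fixes y :: "'a::field_char_0"
  assumes "algebraic_int u" "algebraic_int v" "y ^ 3 + u * y + v = 0"
  shows "algebraic_int y"
proof (rule algebraic_int_monic_root)
  show "y ^ 3 = (\<Sum>i<3. ([-v, -u, 0] ! i) * y ^ i)"
    using assms(3) by (simp add: numeral_3_eq_3 algebra_simps eq_neg_iff_add_eq_0)
  show "algebraic_int ([-v, -u, 0] ! i)" if "i < 3" for i
    using that assms by (auto simp: less_Suc_eq numeral_3_eq_3)
qed

lemma algebraic_int_monic_quadratic:
  fixes y :: "'a::field_char_0"
  assumes "algebraic_int u" "algebraic_int v" "y ^ 2 + u * y + v = 0"
  shows "algebraic_int y"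
proof (rule algebraic_int_monic_root)
  show "y ^ 2 = (\<Sum>i<2. ([-v, -u] ! i) * y ^ i)"
    using assms(3) by (simp add: numeral_2_eq_2 algebra_simps eq_neg_iff_add_eq_0)
  show "algebraic_int ([-v, -u] ! i)" if "i < 2" for i
    using that assms by (auto simp: less_Suc_eq numeral_2_eq_2)
qed

section \<open>Primes in rings of algebraic integers of finite rank\<close>

lemma clear_denominators:
  fixes u :: "'b \<Rightarrow> rat"
  assumes "finite S"
  shows "\<exists>D>0. \<exists>c. \<forall>v\<in>S. of_int D * u v = of_int (c v)"
  using assms
proof (induction rule: finite_induct)
  case empty
  show ?case by (intro exI[of _ 1]) auto
next
  case (insert w S)
  then obtain D c where D: "D > 0" "\<And>v. v \<in> S \<Longrightarrow> of_int D * u v = of_int (c v)" by blast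
  obtain m k where mk: "u w = of_int m / of_int k" "k > 0"
    by (metis quotient_of_div quotient_of_denom_pos surj_pair)
  have "of_int (D * k) * u v = of_int (if v = w then D * m else c v * k)" if "v \<in> insert w S" for v
    using that D(2)[of v] mk insert.hyps by auto
  then have "\<forall>v\<in>insert w S. of_int (D * k) * u v = of_int ((\<lambda>v. if v = w then D * m else c v * k) v)"
    by blast
  moreover have "D * k > 0" using D(1) mk(2) by simp
  ultimately show ?case by (intro exI[of _ "D * k"] conjI exI)
qed

text \<open>The combinations of the elements of \<open>G\<close> with coefficients in \<open>W\<close>. For \<open>W\<close> a ring
  this is the module that \<open>G\<close> generates over \<open>W\<close>; for \<open>W\<close> an ideal \<open>P\<close> it is
  \<open>P\<close> times that module.\<close>

definition lin :: "'a::comm_ring_1 set \<Rightarrow> 'a set \<Rightarrow> 'a set" where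
  "lin W G = {\<Sum>g\<in>G. a g * g | a. \<forall>g\<in>G. a g \<in> W}"

lemma linI: "(\<And>g. g \<in> G \<Longrightarrow> a g \<in> W) \<Longrightarrow> (\<Sum>g\<in>G. a g * g) \<in> lin W G"
  by (auto simp: lin_def)

lemma lin_mult:
  assumes "\<And>c. c \<in> V \<Longrightarrow> r * c \<in> W" "x \<in> lin V G"
  shows "r * x \<in> lin W G"
proof -
  obtain a where "x = (\<Sum>g\<in>G. a g * g)" "\<forall>g\<in>G. a g \<in> V"
    using assms(2) unfolding lin_def by blast
  moreover from this have "(\<Sum>g\<in>G. (r * a g) * g) \<in> lin W G"
    using assms(1) by (intro linI) auto
  ultimately show ?thesis by (simp add: algebra_simps sum_distrib_left)
qed

text \<open>A nonzero prime ideal \<open>P\<close> of a ring \<open>R\<close> of algebraic integers whose elements span a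
  rational vector space of finite dimension. Both are plain subsets of the ambient field.\<close>

locale integer_prime =
  fixes R P :: "'a::field_char_0 set"
  assumes one_R: "1 \<in> R"
    and add_R: "\<lbrakk>x \<in> R; y \<in> R\<rbrakk> \<Longrightarrow> x + y \<in> R"
    and minus_R: "x \<in> R \<Longrightarrow> - x \<in> R"
    and mult_R: "\<lbrakk>x \<in> R; y \<in> R\<rbrakk> \<Longrightarrow> x * y \<in> R"
    and integral_R: "x \<in> R \<Longrightarrow> algebraic_int x"
    and finite_rank: "\<exists>B. finite B \<and> R \<subseteq> rat_span.span B"
    and P_R: "x \<in> P \<Longrightarrow> x \<in> R"
    and add_P: "\<lbrakk>x \<in> P; y \<in> P\<rbrakk> \<Longrightarrow> x + y \<in> P"
    and mult_P: "\<lbrakk>a \<in> R; x \<in> P\<rbrakk> \<Longrightarrow> a * x \<in> P"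
    and one_notin_P: "1 \<notin> P"
    and prime_P: "\<lbrakk>a \<in> R; b \<in> R; a * b \<in> P\<rbrakk> \<Longrightarrow> a \<in> P \<or> b \<in> P"
    and nonzero_P: "\<exists>x\<in>P. x \<noteq> 0"
begin

lemma zero_P: "0 \<in> P"
  using nonzero_P P_R add_P mult_P minus_R one_R
  by (metis add.right_inverse mult_minus1)

lemma zero_R: "0 \<in> R"
  using zero_P P_R by blast

lemma minus_P: "x \<in> P \<Longrightarrow> - x \<in> P"
  using mult_P[of "-1" x] minus_R one_R by simp

lemma diff_P: "\<lbrakk>x \<in> P; y \<in> P\<rbrakk> \<Longrightarrow> x - y \<in> P"
  using add_P[of x "- y"] minus_P by simp

lemma diff_R: "\<lbrakk>x \<in> R; y \<in> R\<rbrakk> \<Longrightarrow> x - y \<in> R"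
  using add_R[of x "- y"] minus_R by simp

lemma of_int_R: "of_int k \<in> R"
proof (cases k rule: int_cases2)
  case (nonneg n)
  have "of_nat n \<in> R" by (induction n) (auto intro: add_R one_R zero_R)
  then show ?thesis by (simp add: nonneg)
next
  case (nonpos n)
  have "of_nat n \<in> R" by (induction n) (auto intro: add_R one_R zero_R)
  then show ?thesis by (simp add: nonpos minus_R)
qed

lemma poly_R: "x \<in> R \<Longrightarrow> poly (map_poly of_int f) x \<in> R"
  by (induction f) (auto simp: map_poly_pCons intro: add_R mult_R of_int_R zero_R)

lemma of_int_mult_P: "p dvd k \<Longrightarrow> of_int p \<in> P \<Longrightarrow> of_int k \<in> P"
  using mult_P[OF of_int_R] by (elim dvdE) (simp add: mult.commute[of p])

lemma nonzero_int_in_P: "\<exists>k. k \<noteq> 0 \<and> of_int k \<in> P"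
proof -
  obtain x where x: "x \<in> P" "x \<noteq> 0" using nonzero_P by blast
  obtain f where "poly (map_poly of_int f) x = 0" "Polynomial.lead_coeff f = 1"
    using integral_R[OF P_R[OF x(1)]] algebraic_int_altdef_ipoly by blast
  moreover have "\<exists>k. k \<noteq> 0 \<and> of_int k \<in> P" if "poly (map_poly of_int f) x = 0" "f \<noteq> 0" for f
    using that
  proof (induction f)
    case (pCons a g)
    let ?y = "poly (map_poly of_int g) x"
    have eq: "of_int a = - (?y * x)"
      using pCons.prems by (simp add: map_poly_pCons eq_neg_iff_add_eq_0 mult.commute)
    show ?case
    proof (cases "a = 0")
      case True
      then show ?thesis using pCons x eq by auto
    next
      case False
      have "of_int a \<in> P"
        unfolding eq using poly_R[OF P_R[OF x(1)]] x(1) by (intro minus_P mult_P)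
      with False show ?thesis by blast
    qed
  qed simp
  ultimately show ?thesis by fastforce
qed

lemma prime_number_in_P: "\<exists>p::int. prime p \<and> of_int p \<in> P"
proof -
  obtain k where k: "k \<noteq> 0" "of_int k \<in> P" using nonzero_int_in_P by blast
  have "(of_nat (nat \<bar>k\<bar>) :: 'a) \<in> P"
    using k minus_P[OF k(2)] by (cases "k \<ge> 0") auto
  moreover have "\<exists>p::int. prime p \<and> of_int p \<in> P" if "(of_nat n :: 'a) \<in> P" "n > 0" for n
    using that
  proof (induction n rule: less_induct)
    case (less n)
    have "n \<noteq> 1" using less.prems one_notin_P by auto
    then obtain p where p: "prime p" "p dvd n" using prime_factor_nat by blast
    then obtain m where m: "n = p * m" by blast
    have "(of_nat p :: 'a) \<in> P \<or> (of_nat m :: 'a) \<in> P"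
      using less.prems m by (intro prime_P) (auto simp: of_int_R[of "int _", simplified])
    moreover have "m < n" "m > 0" using m less.prems p prime_gt_1_nat[of p] by auto
    moreover have "prime (int p)" using p by simp
    ultimately show ?case using less.IH[of m] by (metis of_int_of_nat_eq)
  qed
  moreover have "nat \<bar>k\<bar> > 0" using k(1) by simp
  ultimately show ?thesis by blast
qed

text \<open>The residue ring is a domain that is integral over the field with \<open>p\<close> elements, hence a
  field.\<close>

lemma inverse_mod_P:
  assumes x: "x \<in> R" "x \<notin> P"
  shows "\<exists>c\<in>R. c * x - 1 \<in> P"
proof -
  obtain p :: int where p: "prime p" "of_int p \<in> P" using prime_number_in_P by blast
  obtain f where f: "poly (map_poly of_int f) x = 0" "Polynomial.lead_coeff f = 1"
    using integral_R[OF x(1)] algebraic_int_altdef_ipoly by blast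
  \<comment> \<open>It suffices that some polynomial, nonzero modulo \<open>p\<close>, vanishes at \<open>x\<close> modulo
    \<open>P\<close>: either its constant term is invertible modulo \<open>p\<close>, or \<open>x\<close> can be divided
    out.\<close>
  have "\<exists>c\<in>R. c * x - 1 \<in> P"
    if "poly (map_poly of_int f) x \<in> P" "\<not> p dvd Polynomial.coeff f i" for f i
    using that
  proof (induction f arbitrary: i)
    case (pCons a g)
    let ?y = "poly (map_poly of_int g) x"
    have y: "?y \<in> R" using x by (intro poly_R)
    have "poly (map_poly of_int (pCons a g)) x = of_int a + x * ?y"
      by (simp only: of_int_hom.map_poly_pCons_hom poly_pCons)
    then have val: "of_int a + x * ?y \<in> P" using pCons.prems(1) by simp
    show ?case
    proof (cases "p dvd a")
      case True
      then have "x * ?y \<in> P" using diff_P[OF val of_int_mult_P[OF True p(2)]] by simp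
      then have "?y \<in> P" using prime_P x y by blast
      moreover obtain j where "\<not> p dvd Polynomial.coeff g j"
        using pCons.prems(2) True by (cases i) auto
      ultimately show ?thesis using pCons.IH by blast
    next
      case False
      then have "coprime a p" using p(1) by (metis coprime_commute prime_imp_coprime)
      then obtain m k where "m * a + k * p = 1" using bezout_int[of a p] by auto
      then have "a * m - 1 = p * (- k)" by (simp add: algebra_simps)
      then have "p dvd a * m - 1" by (metis dvd_triv_left)
      then have 1: "of_int (a * m - 1) \<in> P" using of_int_mult_P p(2) by blast
      have 2: "of_int m * (of_int a + x * ?y) \<in> P" using mult_P[OF of_int_R val] .
      have "(- of_int m * ?y) * x - 1 = of_int (a * m - 1) - of_int m * (of_int a + x * ?y)"
        by (simp add: algebra_simps)
      then have "(- of_int m * ?y) * x - 1 \<in> P"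
        using diff_P[OF 1 2] by (simp only:)
      moreover have "- of_int m * ?y \<in> R" using y by (intro mult_R minus_R of_int_R)
      ultimately show ?thesis by blast
    qed
  qed simp
  from this[of f "Polynomial.degree f"] f p show ?thesis
    using zero_P not_prime_unit by auto
qed

lemma lin_add: "\<lbrakk>W = R \<or> W = P; x \<in> lin W G; y \<in> lin W G\<rbrakk> \<Longrightarrow> x + y \<in> lin W G"
proof -
  assume W: "W = R \<or> W = P" and "x \<in> lin W G" "y \<in> lin W G"
  then obtain a b where "x = (\<Sum>g\<in>G. a g * g)" "\<forall>g\<in>G. a g \<in> W"
      "y = (\<Sum>g\<in>G. b g * g)" "\<forall>g\<in>G. b g \<in> W" unfolding lin_def by blast
  moreover from this have "(\<Sum>g\<in>G. (a g + b g) * g) \<in> lin W G"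
    using W add_R add_P by (intro linI) auto
  ultimately show ?thesis by (simp add: algebra_simps sum.distrib)
qed

text \<open>The quotient of \<open>R\<close> by \<open>p\<close> has dimension at most the rational dimension of the span of
  \<open>R\<close>, because integral relations can be made primitive. So a maximal subset of \<open>P\<close> that is
  independent modulo \<open>p\<close> is finite, and together with \<open>p\<close> it generates \<open>P\<close>.\<close>

lemma finitely_generated_P: "\<exists>G. finite G \<and> G \<subseteq> P \<and> P \<subseteq> lin R G"
proof -
  obtain p :: int where p: "prime p" "of_int p \<in> P" using prime_number_in_P by blast
  have p0: "p > 1" using p(1) prime_gt_1_int by blast
  obtain B where B: "finite B" "R \<subseteq> rat_span.span B" using finite_rank by blast
  define indep where "indep S \<longleftrightarrow> finite S \<and> S \<subseteq> P \<and>
    (\<forall>c a. a \<in> R \<longrightarrow> (\<Sum>v\<in>S. of_int (c v) * v) = of_int p * a \<longrightarrow> (\<forall>v\<in>S. p dvd c v))"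
    for S :: "'a set"
  have card: "card S \<le> card B" if S: "indep S" for S
  proof -
    have "rat_span.independent S"
    proof
      assume "rat_span.dependent S"
      then obtain u w where u: "w \<in> S" "u w \<noteq> 0" "(\<Sum>v\<in>S. of_rat (u v) * v) = 0"
        using S rat_span.dependent_finite[of S] by (auto simp: indep_def)
      obtain D c where D: "D > 0" "\<And>v. v \<in> S \<Longrightarrow> of_int D * u v = of_int (c v)"
        using clear_denominators[of S u] S by (auto simp: indep_def)
      \<comment> \<open>Dividing by the content yields a relation in which \<open>p\<close> still divides every
        coefficient, which a primitive relation excludes.\<close>
      define g where "g = Gcd (c ` S)"
      have "of_int D * u w \<noteq> 0" using D(1) u(2) by simp
      then have "c w \<noteq> 0" unfolding D(2)[OF u(1)] by simp
      then have g0: "g \<noteq> 0" using u(1) by (auto simp: g_def)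
      have c: "c v = g * (c v div g)" if "v \<in> S" for v
        using that by (simp add: g_def)
      have "of_int g * (\<Sum>v\<in>S. of_int (c v div g) * v) = (\<Sum>v\<in>S. of_int (c v) * v)"
        unfolding sum_distrib_left
        by (intro sum.cong refl) (metis c mult.assoc of_int_mult)
      also have "\<dots> = (\<Sum>v\<in>S. of_int D * (of_rat (u v) * v))"
      proof (intro sum.cong refl)
        fix v assume "v \<in> S"
        then have "of_rat (of_int D * u v) = (of_rat (of_int (c v)) :: 'a)" using D by simp
        then show "of_int (c v) * v = of_int D * (of_rat (u v) * v)"
          by (simp add: of_rat_mult)
      qed
      also have "\<dots> = 0" using u(3) by (simp flip: sum_distrib_left)
      finally have "(\<Sum>v\<in>S. of_int (c v div g) * v) = of_int p * 0" using g0 by simp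
      then have "\<forall>v\<in>S. p dvd c v div g"
        using S[unfolded indep_def, THEN conjunct2, THEN conjunct2, rule_format, OF zero_R,
            of "\<lambda>v. c v div g"] by blast
      then have "g * p dvd c v" if "v \<in> S" for v
        using c[OF that] that by (metis dvd_refl mult_dvd_mono)
      then have "g * p dvd g" unfolding g_def by (intro Gcd_greatest) auto
      then show False using g0 p0 by simp
    qed
    moreover have "S \<subseteq> rat_span.span B" using S P_R B(2) by (auto simp: indep_def)
    ultimately show ?thesis using rat_span.independent_span_bound[OF B(1)] by blast
  qed
  have "indep {}" by (simp add: indep_def)
  then obtain S where S: "indep S" and max: "\<And>T. indep T \<Longrightarrow> card T \<le> card S"
    using ex_has_greatest_nat[where P = indep and k = "{}" and f = card and b = "Suc (card B)"]
      card less_Suc_eq_le by metis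
  define G where "G = insert (of_int p) S"
  have G: "finite G" "G \<subseteq> P" using S p by (auto simp: G_def indep_def)
  have base: "g \<in> lin R G" if "g \<in> G" for g
  proof -
    have "(\<Sum>h\<in>G. (if h = g then 1 else 0) * h) = (\<Sum>h\<in>G. if h = g then g else 0)"
      by (intro sum.cong) auto
    also have "\<dots> = g" using that G by simp
    finally show ?thesis using linI[of G "\<lambda>h. if h = g then 1 else 0" R] one_R zero_R by auto
  qed
  have lin_R: "r * y \<in> lin R G" if "r \<in> R" "y \<in> lin R G" for r y
    using lin_mult[of R r R y G] mult_R that by blast
  have lin_sum: "(\<Sum>i\<in>I. f i) \<in> lin R G" if "\<And>i. i \<in> I \<Longrightarrow> f i \<in> lin R G" for I and f :: "'a \<Rightarrow> 'a"
    using that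
  proof (induction I rule: infinite_finite_induct)
    case (insert i I)
    then show ?case by (auto intro: lin_add)
  qed (use linI[of G "\<lambda>_. 0" R] zero_R in auto)
  have "x \<in> lin R G" if x: "x \<in> P" for x
  proof (cases "x \<in> S")
    case True
    then show ?thesis using base[of x] by (simp add: G_def)
  next
    case False
    then have "card (insert x S) > card S" using S by (simp add: indep_def)
    then have "\<not> indep (insert x S)" using max by fastforce
    then obtain c a v where a: "a \<in> R" "(\<Sum>v\<in>insert x S. of_int (c v) * v) = of_int p * a"
      and v: "v \<in> insert x S" "\<not> p dvd c v"
      using S x by (auto simp: indep_def)
    have eq: "of_int (c x) * x + (\<Sum>v\<in>S. of_int (c v) * v) = of_int p * a"
      using a False S by (simp add: indep_def)
    have "\<not> p dvd c x"
    proof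
      assume "p dvd c x"
      then obtain k where k: "c x = p * k" by blast
      have "(\<Sum>v\<in>S. of_int (c v) * v) = of_int p * (a - of_int k * x)"
        using eq by (simp add: k algebra_simps)
      moreover have "a - of_int k * x \<in> R" using a x P_R by (intro diff_R mult_R of_int_R) auto
      ultimately have "\<forall>v\<in>S. p dvd c v" using S unfolding indep_def by blast
      then show False using v \<open>p dvd c x\<close> by auto
    qed
    then have "coprime (c x) p" using p(1) by (metis coprime_commute prime_imp_coprime)
    then obtain m l where "m * c x + l * p = 1" using bezout_int[of "c x" p] by auto
    define k where "k = - l"
    have k: "c x * m - 1 = p * k" using \<open>m * c x + l * p = 1\<close> by (simp add: k_def algebra_simps)
    have "x = of_int (c x * m) * x - of_int (c x * m - 1) * x" by (simp add: algebra_simps)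
    also have "\<dots> = of_int m * (of_int p * a - (\<Sum>v\<in>S. of_int (c v) * v)) - of_int (p * k) * x"
      unfolding k[symmetric] eq[symmetric] by (simp add: algebra_simps)
    also have "\<dots> = (of_int m * a - of_int k * x) * of_int p + of_int (- m) * (\<Sum>v\<in>S. of_int (c v) * v)"
      by (simp add: algebra_simps)
    also have "\<dots> \<in> lin R G"
    proof (intro lin_add lin_R lin_sum)
      show "of_int m * a - of_int k * x \<in> R"
        using a x P_R by (intro diff_R mult_R of_int_R) auto
    qed (use base G_def of_int_R of_int_R[of "- m"] in auto)
    finally show ?thesis .
  qed
  then show ?thesis using G by blast
qed

text \<open>The product of the ideal \<open>P\<close> with itself.\<close>

abbreviation square_P :: "'a set" where
  "square_P \<equiv> ideal_prod (ambient\<lparr>carrier := R\<rparr>) P P"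

lemma square_P_prod: "x \<in> P \<Longrightarrow> y \<in> P \<Longrightarrow> x * y \<in> square_P"
  using ideal_prod.prod[of x P y P "ambient\<lparr>carrier := R\<rparr>"] by (simp add: ring_of_type_algebra_def)

lemma square_P_add: "x \<in> square_P \<Longrightarrow> y \<in> square_P \<Longrightarrow> x + y \<in> square_P"
  using ideal_prod.sum[of x "ambient\<lparr>carrier := R\<rparr>" P P y] by (simp add: ring_of_type_algebra_def)

lemma square_P_induct [consumes 1, case_names prod add]:
  assumes "z \<in> square_P" "\<And>x y. x \<in> P \<Longrightarrow> y \<in> P \<Longrightarrow> Q (x * y)"
    "\<And>x y. Q x \<Longrightarrow> Q y \<Longrightarrow> Q (x + y)"
  shows "Q z"
  using assms(1)
  by (induction rule: ideal_prod.induct) (use assms in \<open>auto simp: ring_of_type_algebra_def\<close>)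

lemma square_P_mult:
  assumes "r \<in> R" "x \<in> square_P"
  shows "r * x \<in> square_P"
  using assms(2)
proof (induction rule: square_P_induct)
  case (prod x y)
  then show ?case using square_P_prod[of "r * x" y] mult_P[OF assms(1)] by (simp add: mult.assoc)
next
  case (add x y)
  then show ?case by (simp add: square_P_add distrib_left)
qed

lemma square_P_diff: "x \<in> square_P \<Longrightarrow> y \<in> square_P \<Longrightarrow> x - y \<in> square_P"
  using square_P_add[OF _ square_P_mult[of "-1" y]] minus_R one_R by simp

text \<open>Nakayama's lemma: if \<open>P\<close> were equal to its square, then the generators could be removed
  one after the other at the cost of multiplying \<open>P\<close> by an element outside \<open>P\<close>.\<close>

lemma P_not_idempotent: "\<not> P \<subseteq> square_P"
proof
  assume idem: "P \<subseteq> square_P"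
  have "False" if "finite G" "G \<subseteq> P" "u \<in> R" "u \<notin> P" "\<And>x. x \<in> P \<Longrightarrow> u * x \<in> lin R G" for G u
    using that
  proof (induction arbitrary: u rule: finite_induct)
    case empty
    then show ?case using nonzero_P zero_P by (auto simp: lin_def)
  next
    case (insert g G)
    have up: "u * x \<in> lin P (insert g G)" if "x \<in> square_P" for x
      using that
    proof (induction rule: square_P_induct)
      case (prod x y)
      have "y * (u * x) \<in> lin P (insert g G)"
        using insert.prems(4)[OF prod(1)] prod(2) mult_P
        by (intro lin_mult[of R y P]) (auto simp: mult.commute)
      then show ?case by (simp add: mult_ac)
    next
      case (add x y)
      then show ?case by (simp add: lin_add distrib_left)
    qed
    have "g \<in> square_P" using insert.prems idem by auto
    then obtain a where a: "u * g = a g * g + (\<Sum>v\<in>G. a v * v)" "\<forall>v\<in>insert g G. a v \<in> P"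
      using up[of g] insert.hyps unfolding lin_def by auto
    define w where "w = u - a g"
    have w: "w \<in> R" "w \<notin> P"
      using insert.prems a(2) P_R diff_R add_P[of w "a g"] by (auto simp: w_def)
    have wg: "w * g \<in> lin R G"
      using linI[of G a R] a P_R by (auto simp: w_def algebra_simps)
    have "(w * u) * x \<in> lin R G" if x: "x \<in> P" for x
    proof -
      obtain c where c: "u * x = c g * g + (\<Sum>v\<in>G. c v * v)" "\<forall>v\<in>insert g G. c v \<in> R"
        using insert.prems(4)[OF x] insert.hyps unfolding lin_def by auto
      have "(w * u) * x = w * (u * x)" by (simp add: mult.assoc)
      also have "\<dots> = c g * (w * g) + w * (\<Sum>v\<in>G. c v * v)"
        by (simp add: c algebra_simps)
      also have "\<dots> \<in> lin R G"
        using lin_mult[of R "c g" R "w * g" G] lin_mult[of R w R "\<Sum>v\<in>G. c v * v" G]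
          linI[of G c R] wg c(2) w mult_R by (intro lin_add) auto
      finally show ?thesis .
    qed
    moreover have "w * u \<in> R" "w * u \<notin> P" using w insert.prems(2,3) mult_R prime_P[of w u] by auto
    ultimately show ?case using insert.IH[of "w * u"] insert.prems by blast
  qed
  moreover obtain G where "finite G" "G \<subseteq> P" "P \<subseteq> lin R G" using finitely_generated_P by blast
  ultimately show False using one_R one_notin_P by (metis mult_1 subsetD)
qed

lemma cancel_mod_square_P:
  assumes "a \<in> R" "a \<notin> P" "x \<in> P" "a * x \<in> square_P"
  shows "x \<in> square_P"
proof -
  obtain c where c: "c \<in> R" "c * a - 1 \<in> P" using inverse_mod_P assms by blast
  have "c * (a * x) - (c * a - 1) * x \<in> square_P"
    using c assms by (intro square_P_diff square_P_mult[OF c(1)] square_P_prod assms(3,4) c(2))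
  then show ?thesis by (simp add: algebra_simps)
qed

text \<open>The ramification argument. The map \<open>\<sigma>\<close> generates a cyclic group of order 3, and the element
  \<open>y\<close> witnesses that this group does not act trivially modulo \<open>P\<close>. As the order is prime, the
  homomorphisms \<open>id\<close>, \<open>\<sigma>\<close>, \<open>\<sigma>\<^sup>2\<close> from \<open>R\<close> to the residue field are then
  pairwise distinct, hence linearly independent by Artin's argument. If all traces of multiples of an
  element \<open>\<pi>\<close> lay in the square of \<open>P\<close>, independence would put \<open>\<pi>\<close> itself there.\<close>

lemma trace_notin_square_P:
  assumes \<sigma>_R: "\<And>x. x \<in> R \<Longrightarrow> \<sigma> x \<in> R"
    and \<sigma>_mult: "\<And>x y. x \<in> R \<Longrightarrow> y \<in> R \<Longrightarrow> \<sigma> (x * y) = \<sigma> x * \<sigma> y"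
    and \<sigma>_one: "\<sigma> 1 = 1"
    and \<sigma>_order: "\<And>x. x \<in> R \<Longrightarrow> \<sigma> (\<sigma> (\<sigma> x)) = x"
    and y: "y \<in> R" "\<not> (\<sigma> y - y \<in> P \<and> \<sigma> (\<sigma> y) - y \<in> P)"
  shows "\<exists>x\<in>P. x + \<sigma> x + \<sigma> (\<sigma> x) \<in> P \<and> x + \<sigma> x + \<sigma> (\<sigma> x) \<notin> square_P"
proof -
  have "\<exists>\<alpha>\<in>R. \<alpha> - \<sigma> \<alpha> \<notin> P"
  proof (rule ccontr)
    assume "\<not> ?thesis"
    then have "y - \<sigma> y \<in> P" "\<sigma> y - \<sigma> (\<sigma> y) \<in> P" using y \<sigma>_R by auto
    then show False using y(2) add_P[of "y - \<sigma> y" "\<sigma> y - \<sigma> (\<sigma> y)"] minus_P by fastforce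
  qed
  then obtain \<alpha> where \<alpha>: "\<alpha> \<in> R" "\<alpha> - \<sigma> \<alpha> \<notin> P" by blast
  have "\<exists>\<beta>\<in>R. \<beta> - \<sigma> (\<sigma> \<beta>) \<notin> P"
  proof (rule ccontr)
    assume "\<not> ?thesis"
    then have "y - \<sigma> (\<sigma> y) \<in> P" "\<sigma> (\<sigma> y) - \<sigma> y \<in> P"
      using y(1) \<sigma>_R \<sigma>_order by (metis (no_types))+
    then show False using y(2) add_P[of "y - \<sigma> (\<sigma> y)" "\<sigma> (\<sigma> y) - \<sigma> y"] minus_P by fastforce
  qed
  then obtain \<beta> where \<beta>: "\<beta> \<in> R" "\<beta> - \<sigma> (\<sigma> \<beta>) \<notin> P" by blast
  \<comment> \<open>The element \<open>\<pi>\<close> and its conjugates must all lie in \<open>P\<close>. If \<open>\<tau>\<close> does not map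
    \<open>P\<close> into itself, a factor outside \<open>P\<close> whose image lies in \<open>P\<close> achieves this.\<close>
  have avoid: "\<exists>a\<in>R. a \<notin> P \<and> (\<forall>x\<in>P. \<tau> (a * x) \<in> P)"
    if \<tau>: "\<And>x. x \<in> R \<Longrightarrow> \<tau> x \<in> R" "\<And>x y. x \<in> R \<Longrightarrow> y \<in> R \<Longrightarrow> \<tau> (x * y) = \<tau> x * \<tau> y"
      "\<And>x. x \<in> R \<Longrightarrow> \<tau> (\<tau> (\<tau> x)) = x" for \<tau>
  proof (cases "\<exists>a\<in>R. a \<notin> P \<and> \<tau> a \<in> P")
    case True
    then obtain a where a: "a \<in> R" "a \<notin> P" "\<tau> a \<in> P" by blast
    have "\<tau> (a * x) \<in> P" if "x \<in> P" for x
      using mult_P[of "\<tau> x" "\<tau> a"] a \<tau> P_R[OF that] by (simp add: mult.commute)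
    with a show ?thesis by blast
  next
    case False
    then have "\<tau> x \<in> P" if "x \<in> P" for x
      using that \<tau>(1,3) P_R by metis
    then show ?thesis using one_R one_notin_P by (metis mult_1)
  qed
  obtain a1 where a1: "a1 \<in> R" "a1 \<notin> P" "\<And>x. x \<in> P \<Longrightarrow> \<sigma> (a1 * x) \<in> P"
    using avoid[of \<sigma>] \<sigma>_R \<sigma>_mult \<sigma>_order by blast
  obtain a2 where a2: "a2 \<in> R" "a2 \<notin> P" "\<And>x. x \<in> P \<Longrightarrow> \<sigma> (\<sigma> (a2 * x)) \<in> P"
    using avoid[of "\<lambda>x. \<sigma> (\<sigma> x)"] \<sigma>_R \<sigma>_mult \<sigma>_order by auto
  obtain \<rho> where \<rho>: "\<rho> \<in> P" "\<rho> \<notin> square_P" using P_not_idempotent by blast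
  define \<pi> where "\<pi> = a1 * (a2 * \<rho>)"
  have \<pi>: "\<pi> \<in> P" using \<rho> a1 a2 by (auto simp: \<pi>_def intro: mult_P)
  have \<pi>': "\<pi> \<notin> square_P"
    using cancel_mod_square_P[of a1 "a2 * \<rho>"] cancel_mod_square_P[of a2 \<rho>] \<rho> a1 a2 mult_P
    by (auto simp: \<pi>_def)
  have \<sigma>\<pi>: "\<sigma> \<pi> \<in> P" using a1(3) mult_P[OF a2(1) \<rho>(1)] by (simp add: \<pi>_def)
  have "\<sigma> (\<sigma> (a2 * (a1 * \<rho>))) \<in> P" using a2(3) mult_P[OF a1(1) \<rho>(1)] by blast
  then have \<sigma>\<sigma>\<pi>: "\<sigma> (\<sigma> \<pi>) \<in> P" by (simp add: \<pi>_def mult_ac)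
  define tr where "tr x = x * \<pi> + \<sigma> x * \<sigma> \<pi> + \<sigma> (\<sigma> x) * \<sigma> (\<sigma> \<pi>)" for x
  have tr_eq: "tr x = x * \<pi> + \<sigma> (x * \<pi>) + \<sigma> (\<sigma> (x * \<pi>))" if "x \<in> R" for x
    using that \<sigma>_R \<sigma>_mult P_R[OF \<pi>] by (simp add: tr_def)
  have "\<exists>x\<in>R. tr x \<notin> square_P"
  proof (rule ccontr)
    assume "\<not> ?thesis"
    then have tr: "tr x \<in> square_P" if "x \<in> R" for x using that by blast
    \<comment> \<open>Replacing \<open>x\<close> by \<open>\<alpha> * x\<close> eliminates the term that contains \<open>\<sigma> x\<close>; in the
      same way \<open>\<beta>\<close> then eliminates the term that contains \<open>\<sigma> (\<sigma> x)\<close>.\<close>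
    have g: "(\<alpha> - \<sigma> \<alpha>) * x * \<pi> + (\<sigma> (\<sigma> \<alpha>) - \<sigma> \<alpha>) * \<sigma> (\<sigma> x) * \<sigma> (\<sigma> \<pi>) \<in> square_P"
      if "x \<in> R" for x
    proof -
      have "tr (\<alpha> * x) - \<sigma> \<alpha> * tr x \<in> square_P"
        using that \<alpha> \<sigma>_R by (intro square_P_diff square_P_mult tr mult_R)
      then show ?thesis using that \<alpha> \<sigma>_R \<sigma>_mult by (simp add: tr_def algebra_simps)
    qed
    have "((\<alpha> - \<sigma> \<alpha>) * \<beta> * \<pi> + (\<sigma> (\<sigma> \<alpha>) - \<sigma> \<alpha>) * \<sigma> (\<sigma> \<beta>) * \<sigma> (\<sigma> \<pi>)) -
      \<sigma> (\<sigma> \<beta>) * ((\<alpha> - \<sigma> \<alpha>) * 1 * \<pi> + (\<sigma> (\<sigma> \<alpha>) - \<sigma> \<alpha>) * \<sigma> (\<sigma> 1) * \<sigma> (\<sigma> \<pi>)) \<in> square_P"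
      using \<beta>(1) one_R by (intro square_P_diff square_P_mult g \<sigma>_R)
    then have "((\<alpha> - \<sigma> \<alpha>) * (\<beta> - \<sigma> (\<sigma> \<beta>))) * \<pi> \<in> square_P"
      by (simp add: \<sigma>_one algebra_simps)
    moreover have "(\<alpha> - \<sigma> \<alpha>) * (\<beta> - \<sigma> (\<sigma> \<beta>)) \<in> R" "(\<alpha> - \<sigma> \<alpha>) * (\<beta> - \<sigma> (\<sigma> \<beta>)) \<notin> P"
      using \<alpha> \<beta> \<sigma>_R prime_P[of "\<alpha> - \<sigma> \<alpha>" "\<beta> - \<sigma> (\<sigma> \<beta>)"]
      by (blast intro: mult_R diff_R)+
    ultimately show False using cancel_mod_square_P \<pi> \<pi>' by blast
  qed
  then obtain x where x: "x \<in> R" "tr x \<notin> square_P" by blast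
  have "tr x \<in> P" unfolding tr_def using x(1) \<pi> \<sigma>\<pi> \<sigma>\<sigma>\<pi> by (intro add_P mult_P \<sigma>_R)
  then show ?thesis
    using x tr_eq[OF x(1)] mult_P[OF x(1) \<pi>] by (intro bexI[of _ "x * \<pi>"]) auto
qed

end

section \<open>Cyclic cubic extensions\<close>

text \<open>A subfield of the ambient field, as a set closed under the operations of the type.\<close>

locale set_field =
  fixes K :: "'a::field_char_0 set"
  assumes one_K: "1 \<in> K"
    and add_K: "\<lbrakk>x \<in> K; y \<in> K\<rbrakk> \<Longrightarrow> x + y \<in> K"
    and minus_K: "x \<in> K \<Longrightarrow> - x \<in> K"
    and mult_K: "\<lbrakk>x \<in> K; y \<in> K\<rbrakk> \<Longrightarrow> x * y \<in> K"
    and inverse_K: "x \<in> K \<Longrightarrow> inverse x \<in> K"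
begin

lemma diff_K: "\<lbrakk>x \<in> K; y \<in> K\<rbrakk> \<Longrightarrow> x - y \<in> K"
  using add_K[of x "- y"] minus_K by simp

lemma divide_K: "\<lbrakk>x \<in> K; y \<in> K\<rbrakk> \<Longrightarrow> x / y \<in> K"
  using mult_K[of x "inverse y"] inverse_K by (simp add: divide_inverse)

lemma zero_K: "0 \<in> K"
  using diff_K[OF one_K one_K] by simp

lemma power_K: "x \<in> K \<Longrightarrow> x ^ n \<in> K"
  by (induction n) (auto intro: one_K mult_K)

lemma numeral_K: "numeral n \<in> K"
proof -
  have "of_nat m \<in> K" for m by (induction m) (auto intro: add_K one_K zero_K)
  from this[of "numeral n"] show ?thesis by simp
qed

lemmas closed_K = one_K zero_K add_K minus_K diff_K mult_K inverse_K divide_K power_K numeral_K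

text \<open>If \<open>a + c * s\<close> were a root with \<open>c\<close> not zero, then so would be \<open>a - c * s\<close>, and
  the third root \<open>- 2 * a\<close> would lie in \<open>K\<close>.\<close>

lemma no_cubic_root_in_quadratic_extension:
  assumes b: "b \<in> K" "q \<in> K" and s: "s\<^sup>2 \<in> K"
    and no_root: "\<And>x. x \<in> K \<Longrightarrow> x ^ 3 + b * x + q \<noteq> 0"
    and ac: "a \<in> K" "c \<in> K"
  shows "(a + c * s) ^ 3 + b * (a + c * s) + q \<noteq> 0"
proof
  assume root: "(a + c * s) ^ 3 + b * (a + c * s) + q = 0"
  define A where "A = a ^ 3 + 3 * a * c\<^sup>2 * s\<^sup>2 + b * a + q"
  define C where "C = 3 * a\<^sup>2 * c + c ^ 3 * s\<^sup>2 + b * c"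
  have AC: "A \<in> K" "C \<in> K" unfolding A_def C_def by (intro closed_K b s ac)+
  have sum: "A + C * s = 0"
    using root by (simp add: A_def C_def power2_eq_square power3_eq_cube algebra_simps)
  have notin: "a + c * s \<notin> K" using root no_root by blast
  have "C = 0"
  proof (rule ccontr)
    assume "C \<noteq> 0"
    then have "s = - A / C" using sum by (simp add: field_simps eq_neg_iff_add_eq_0)
    then have "s \<in> K" using AC closed_K by simp
    then show False using notin ac closed_K by simp
  qed
  then have "A = 0" using sum by simp
  have "c \<noteq> 0" using notin ac by auto
  then have "3 * a\<^sup>2 + c\<^sup>2 * s\<^sup>2 + b = 0"
  proof -
    have "C = c * (3 * a\<^sup>2 + c\<^sup>2 * s\<^sup>2 + b)"
      unfolding C_def by (simp add: power2_eq_square power3_eq_cube algebra_simps)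
    then show ?thesis using \<open>C = 0\<close> \<open>c \<noteq> 0\<close> by simp
  qed
  then have "(- 2 * a) ^ 3 + b * (- 2 * a) + q = 0"
  proof -
    have "(- 2 * a) ^ 3 + b * (- 2 * a) + q = A - 3 * a * (3 * a\<^sup>2 + c\<^sup>2 * s\<^sup>2 + b)"
      unfolding A_def by (simp add: power2_eq_square power3_eq_cube algebra_simps)
    then show ?thesis using \<open>A = 0\<close> \<open>3 * a\<^sup>2 + c\<^sup>2 * s\<^sup>2 + b = 0\<close> by simp
  qed
  moreover have "- 2 * a \<in> K" using ac closed_K by simp
  ultimately show False using no_root by blast
qed

end

text \<open>The extension of \<open>K\<close> by a root \<open>r\<close> of the cubic \<open>x\<^sup>3 + b * x + q\<close> which has no
  root in \<open>K\<close> and whose discriminant is the square of \<open>\<delta> \<in> K\<close>. Then the extension is cyclic of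
  degree 3. The last assumption says that the combinations of \<open>1\<close>, \<open>r\<close>, \<open>r\<^sup>2\<close> over
  \<open>K\<close> are closed under inverses, so that they form a field.\<close>

locale cubic_extension = set_field K for K :: "'a::field_char_0 set" +
  fixes b q r \<delta> :: 'a
  assumes b_K: "b \<in> K" and q_K: "q \<in> K" and \<delta>_K: "\<delta> \<in> K"
    and no_root: "\<And>x. x \<in> K \<Longrightarrow> x ^ 3 + b * x + q \<noteq> 0"
    and root: "r ^ 3 + b * r + q = 0"
    and discriminant: "\<delta>\<^sup>2 = - 4 * b ^ 3 - 27 * q\<^sup>2"
    and inverse_M: "\<And>a0 a1 a2. a0 \<in> K \<Longrightarrow> a1 \<in> K \<Longrightarrow> a2 \<in> K \<Longrightarrow>
      \<exists>c0\<in>K. \<exists>c1\<in>K. \<exists>c2\<in>K. inverse (a0 + a1 * r + a2 * r\<^sup>2) = c0 + c1 * r + c2 * r\<^sup>2"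
begin

text \<open>The field generated by \<open>r\<close> over \<open>K\<close>, by its power basis.\<close>

definition M :: "'a set" where
  "M = {a0 + a1 * r + a2 * r\<^sup>2 | a0 a1 a2. a0 \<in> K \<and> a1 \<in> K \<and> a2 \<in> K}"

lemma M_cases:
  assumes "x \<in> M"
  obtains a0 a1 a2 where "a0 \<in> K" "a1 \<in> K" "a2 \<in> K" "x = a0 + a1 * r + a2 * r\<^sup>2"
  using assms by (auto simp: M_def)

lemma M_I: "a0 \<in> K \<Longrightarrow> a1 \<in> K \<Longrightarrow> a2 \<in> K \<Longrightarrow> a0 + a1 * r + a2 * r\<^sup>2 \<in> M"
  by (auto simp: M_def)

lemma r_notin_K: "r \<notin> K"
  using root no_root by blast

lemma linear_relation_trivial: "a0 \<in> K \<Longrightarrow> a1 \<in> K \<Longrightarrow> a0 + a1 * r = 0 \<Longrightarrow> a0 = 0 \<and> a1 = 0"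
proof (cases "a1 = 0")
  case False
  assume a: "a0 \<in> K" "a1 \<in> K" "a0 + a1 * r = 0"
  then have "r = - a0 / a1" using False by (simp add: field_simps eq_neg_iff_add_eq_0)
  then show ?thesis using r_notin_K a closed_K by simp
qed simp

lemma power_basis_independent:
  assumes a: "a0 \<in> K" "a1 \<in> K" "a2 \<in> K" and sum: "a0 + a1 * r + a2 * r\<^sup>2 = 0"
  shows "a0 = 0 \<and> a1 = 0 \<and> a2 = 0"
proof (cases "a2 = 0")
  case True
  then show ?thesis using linear_relation_trivial a sum by simp
next
  case False
  \<comment> \<open>Division of the cubic by the monic quadratic relation \<open>c0 + c1 * x + x\<^sup>2\<close> leaves the
    quotient \<open>x - c1\<close> and a linear remainder which vanishes at \<open>r\<close>. So \<open>c1\<close> is a root.\<close>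
  define c0 where "c0 = a0 / a2"
  define c1 where "c1 = a1 / a2"
  have c: "c0 \<in> K" "c1 \<in> K" using a closed_K by (simp_all add: c0_def c1_def)
  have "a0 = c0 * a2" "a1 = c1 * a2" using False by (simp_all add: c0_def c1_def)
  then have "a2 * (c0 + c1 * r + r\<^sup>2) = 0" using sum by (simp add: algebra_simps)
  then have quad: "c0 + c1 * r + r\<^sup>2 = 0" using False by simp
  have "(q + c0 * c1) + (b + c1\<^sup>2 - c0) * r = 0"
  proof -
    have "(q + c0 * c1) + (b + c1\<^sup>2 - c0) * r =
        (r ^ 3 + b * r + q) - (r - c1) * (c0 + c1 * r + r\<^sup>2)"
          by (simp add: power2_eq_square power3_eq_cube algebra_simps)
    then show ?thesis using quad root by simp
  qed
  then have "q + c0 * c1 = 0 \<and> b + c1\<^sup>2 - c0 = 0"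
    by (intro linear_relation_trivial closed_K c b_K q_K)
  moreover have "c1 ^ 3 + b * c1 + q = (q + c0 * c1) + c1 * (b + c1\<^sup>2 - c0)"
    by (simp add: power2_eq_square power3_eq_cube algebra_simps)
  ultimately have "c1 ^ 3 + b * c1 + q = 0" by simp
  then show ?thesis using no_root c by blast
qed

lemma K_subset_M: "x \<in> K \<Longrightarrow> x \<in> M"
  using M_I[of x 0 0] zero_K by simp

lemma r_M: "r \<in> M"
  using M_I[of 0 1 0] zero_K one_K by simp

lemma reduce_product:
  assumes "y ^ 3 + b * y + q = 0"
  shows "(a0 + a1 * y + a2 * y\<^sup>2) * (c0 + c1 * y + c2 * y\<^sup>2) =
    (a0 * c0 - q * (a1 * c2 + a2 * c1)) +
    (a0 * c1 + a1 * c0 - b * (a1 * c2 + a2 * c1) - q * (a2 * c2)) * y +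
    (a0 * c2 + a1 * c1 + a2 * c0 - b * (a2 * c2)) * y\<^sup>2"
proof -
  let ?L = "(a0 + a1 * y + a2 * y\<^sup>2) * (c0 + c1 * y + c2 * y\<^sup>2)"
  let ?R = "(a0 * c0 - q * (a1 * c2 + a2 * c1)) +
    (a0 * c1 + a1 * c0 - b * (a1 * c2 + a2 * c1) - q * (a2 * c2)) * y +
    (a0 * c2 + a1 * c1 + a2 * c0 - b * (a2 * c2)) * y\<^sup>2"
  have "?L = ?R + (a1 * c2 + a2 * c1 + a2 * c2 * y) * (y ^ 3 + b * y + q)"
    by (simp add: power2_eq_square power3_eq_cube algebra_simps)
  then show ?thesis using assms by simp
qed

sublocale M: set_field M
proof
  show "1 \<in> M" using K_subset_M one_K .
  show "x + y \<in> M" if xy: "x \<in> M" "y \<in> M" for x y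
  proof -
    obtain a0 a1 a2 where a: "a0 \<in> K" "a1 \<in> K" "a2 \<in> K" "x = a0 + a1 * r + a2 * r\<^sup>2"
      using xy M_cases by blast
    obtain c0 c1 c2 where c: "c0 \<in> K" "c1 \<in> K" "c2 \<in> K" "y = c0 + c1 * r + c2 * r\<^sup>2"
      using xy M_cases by blast
    have "x + y = (a0 + c0) + (a1 + c1) * r + (a2 + c2) * r\<^sup>2"
      by (simp add: a c algebra_simps)
    then show ?thesis by (simp only:) (intro M_I closed_K a c)
  qed
  show "- x \<in> M" if x: "x \<in> M" for x
  proof -
    obtain a0 a1 a2 where a: "a0 \<in> K" "a1 \<in> K" "a2 \<in> K" "x = a0 + a1 * r + a2 * r\<^sup>2"
      using x M_cases by blast
    have "- x = (- a0) + (- a1) * r + (- a2) * r\<^sup>2" by (simp add: a)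
    then show ?thesis using M_I a closed_K by metis
  qed
  show "x * y \<in> M" if xy: "x \<in> M" "y \<in> M" for x y
  proof -
    obtain a0 a1 a2 where a: "a0 \<in> K" "a1 \<in> K" "a2 \<in> K" "x = a0 + a1 * r + a2 * r\<^sup>2"
      using xy M_cases by blast
    obtain c0 c1 c2 where c: "c0 \<in> K" "c1 \<in> K" "c2 \<in> K" "y = c0 + c1 * r + c2 * r\<^sup>2"
      using xy M_cases by blast
    show ?thesis
      unfolding a c reduce_product[OF root] using a c b_K q_K by (intro M_I closed_K)
  qed
  show "inverse x \<in> M" if x: "x \<in> M" for x
    using x inverse_M by (metis M_I M_cases)
qed

text \<open>A second root. With the third root \<open>r''\<close>, the derivative of the cubic at \<open>r\<close> is
  \<open>(r - r') * (r - r'')\<close>, and \<open>\<delta>\<close> is the product of this with \<open>r' - r''\<close>; moreover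
  \<open>r' + r'' = - r\<close>.\<close>

definition r' :: 'a where
  "r' = (\<delta> / (3 * r\<^sup>2 + b) - r) / 2"

lemma deriv_nonzero: "3 * r\<^sup>2 + b \<noteq> 0"
  using power_basis_independent[of b 0 3] b_K closed_K by (auto simp: add.commute)

lemma \<delta>_eq: "\<delta> = (2 * r' + r) * (3 * r\<^sup>2 + b)"
proof -
  have "2 * r' + r = \<delta> / (3 * r\<^sup>2 + b)" 
  proof -
    have "2 * ((e - r) / 2) + r = e" for e by (simp add: field_simps)
    then show ?thesis unfolding r'_def .
  qed
  then show ?thesis using deriv_nonzero by simp
qed

lemma r'_M: "r' \<in> M"
  unfolding r'_def using K_subset_M[OF \<delta>_K] K_subset_M[OF b_K] r_M by (intro M.closed_K)

lemma r'_quadratic: "r'\<^sup>2 + r * r' + r\<^sup>2 + b = 0"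
proof -
  have "(2 * r' + r)\<^sup>2 * (3 * r\<^sup>2 + b)\<^sup>2 = (- 3 * r\<^sup>2 - 4 * b) * (3 * r\<^sup>2 + b)\<^sup>2"
  proof -
    have "r ^ 3 + b * r = - q" using root by (simp add: eq_neg_iff_add_eq_0)
    moreover have "(- 3 * r\<^sup>2 - 4 * b) * (3 * r\<^sup>2 + b)\<^sup>2 = - 4 * b ^ 3 - 27 * (r ^ 3 + b * r)\<^sup>2"
      by (simp add: power2_eq_square power3_eq_cube algebra_simps)
    moreover have "(2 * r' + r)\<^sup>2 * (3 * r\<^sup>2 + b)\<^sup>2 = \<delta>\<^sup>2"
      by (simp only: \<delta>_eq[symmetric] power_mult_distrib[symmetric])
    ultimately show ?thesis using discriminant by simp
  qed
  then have "(2 * r' + r)\<^sup>2 = - 3 * r\<^sup>2 - 4 * b" using deriv_nonzero by simp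
  moreover have "4 * (r'\<^sup>2 + r * r' + r\<^sup>2 + b) = (2 * r' + r)\<^sup>2 - (- 3 * r\<^sup>2 - 4 * b)"
    by (simp add: power2_eq_square power3_eq_cube algebra_simps)
  ultimately have "4 * (r'\<^sup>2 + r * r' + r\<^sup>2 + b) = 0" by simp
  then show ?thesis by (simp only: mult_eq_0_iff zero_neq_numeral[symmetric] simp_thms)
qed

lemma r'_root: "r' ^ 3 + b * r' + q = 0"
proof -
  have "r' ^ 3 + b * r' + q = (r' - r) * (r'\<^sup>2 + r * r' + r\<^sup>2 + b) + (r ^ 3 + b * r + q)"
    by (simp add: power2_eq_square power3_eq_cube algebra_simps)
  then show ?thesis using r'_quadratic root by simp
qed

text \<open>The automorphism of \<open>M\<close> over \<open>K\<close> that maps \<open>r\<close> to \<open>r'\<close>. The choice is of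
  coordinates in the power basis, which are unique; outside \<open>M\<close> the value is arbitrary.\<close>

definition galois :: "'a \<Rightarrow> 'a" where
  "galois x = (SOME y. \<exists>a0\<in>K. \<exists>a1\<in>K. \<exists>a2\<in>K.
     x = a0 + a1 * r + a2 * r\<^sup>2 \<and> y = a0 + a1 * r' + a2 * r'\<^sup>2)"

lemma galois_eq:
  assumes a: "a0 \<in> K" "a1 \<in> K" "a2 \<in> K"
  shows "galois (a0 + a1 * r + a2 * r\<^sup>2) = a0 + a1 * r' + a2 * r'\<^sup>2"
  unfolding galois_def
proof (rule some_equality)
  fix y
  assume "\<exists>c0\<in>K. \<exists>c1\<in>K. \<exists>c2\<in>K.
     a0 + a1 * r + a2 * r\<^sup>2 = c0 + c1 * r + c2 * r\<^sup>2 \<and> y = c0 + c1 * r' + c2 * r'\<^sup>2"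
  then obtain c0 c1 c2 where c: "c0 \<in> K" "c1 \<in> K" "c2 \<in> K"
    "a0 + a1 * r + a2 * r\<^sup>2 = c0 + c1 * r + c2 * r\<^sup>2" "y = c0 + c1 * r' + c2 * r'\<^sup>2" by blast
  have "(a0 - c0) + (a1 - c1) * r + (a2 - c2) * r\<^sup>2 = 0" using c by (simp add: algebra_simps)
  then have "a0 - c0 = 0 \<and> a1 - c1 = 0 \<and> a2 - c2 = 0"
    using a c closed_K by (intro power_basis_independent) auto
  then show "y = a0 + a1 * r' + a2 * r'\<^sup>2" using c by simp
qed (use a in blast)

lemma galois_K: "x \<in> K \<Longrightarrow> galois x = x"
  using galois_eq[of x 0 0] zero_K by simp

lemma galois_r: "galois r = r'"
  using galois_eq[of 0 1 0] zero_K one_K by simp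

lemma galois_add: "x \<in> M \<Longrightarrow> y \<in> M \<Longrightarrow> galois (x + y) = galois x + galois y"
proof -
  assume xy: "x \<in> M" "y \<in> M"
  obtain a0 a1 a2 where a: "a0 \<in> K" "a1 \<in> K" "a2 \<in> K" "x = a0 + a1 * r + a2 * r\<^sup>2"
    using xy M_cases by blast
  obtain c0 c1 c2 where c: "c0 \<in> K" "c1 \<in> K" "c2 \<in> K" "y = c0 + c1 * r + c2 * r\<^sup>2"
    using xy M_cases by blast
  have "x + y = (a0 + c0) + (a1 + c1) * r + (a2 + c2) * r\<^sup>2"
    by (simp add: a c algebra_simps)
  then have "galois (x + y) = (a0 + c0) + (a1 + c1) * r' + (a2 + c2) * r'\<^sup>2"
    using galois_eq a(1-3) c(1-3) closed_K by (simp only:)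
  then show ?thesis unfolding a(4) c(4) galois_eq[OF a(1-3)] galois_eq[OF c(1-3)]
    by (simp add: algebra_simps)
qed

lemma galois_mult: "x \<in> M \<Longrightarrow> y \<in> M \<Longrightarrow> galois (x * y) = galois x * galois y"
proof -
  assume xy: "x \<in> M" "y \<in> M"
  obtain a0 a1 a2 where a: "a0 \<in> K" "a1 \<in> K" "a2 \<in> K" "x = a0 + a1 * r + a2 * r\<^sup>2"
    using xy M_cases by blast
  obtain c0 c1 c2 where c: "c0 \<in> K" "c1 \<in> K" "c2 \<in> K" "y = c0 + c1 * r + c2 * r\<^sup>2"
    using xy M_cases by blast
  show ?thesis
    unfolding a c galois_eq[OF a(1-3)] galois_eq[OF c(1-3)]
    unfolding reduce_product[OF root] reduce_product[OF r'_root]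
    using a c b_K q_K by (intro galois_eq closed_K)
qed

lemma galois_M: "x \<in> M \<Longrightarrow> galois x \<in> M"
proof (elim M_cases)
  fix a0 a1 a2 assume a: "a0 \<in> K" "a1 \<in> K" "a2 \<in> K" "x = a0 + a1 * r + a2 * r\<^sup>2"
  show ?thesis
    unfolding a(4) galois_eq[OF a(1-3)] by (intro M.closed_K r'_M a(1-3)[THEN K_subset_M])
qed

text \<open>The automorphism fixes \<open>\<delta>\<close>, so it permutes the three roots cyclically.\<close>

lemma galois_r': "galois r' = - r - r'"
proof -
  have "galois \<delta> = (2 * galois r' + galois r) * (3 * (galois r)\<^sup>2 + b)"
  proof -
    have "\<delta> = (2 * r' + r) * (3 * (r * r) + b)"
      using \<delta>_eq unfolding power2_eq_square .
    then have "galois \<delta> = galois ((2 * r' + r) * (3 * (r * r) + b))" by (rule arg_cong)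
    also have "\<dots> = (2 * galois r' + galois r) * (3 * (galois r)\<^sup>2 + b)"
      using r_M r'_M M.closed_K K_subset_M[OF b_K] K_subset_M[OF numeral_K]
      by (simp add: galois_add galois_mult galois_K b_K numeral_K power2_eq_square)
    finally show ?thesis .
  qed
  then have 1: "(2 * galois r' + r') * (3 * r'\<^sup>2 + b) = (2 * r' + r) * (3 * r\<^sup>2 + b)"
    unfolding galois_K[OF \<delta>_K] galois_r using \<delta>_eq by (rule trans[OF sym])
  have "(3 * r'\<^sup>2 + b) * galois (inverse (3 * r\<^sup>2 + b)) = galois ((3 * r\<^sup>2 + b) * inverse (3 * r\<^sup>2 + b))"
    using r_M M.closed_K K_subset_M[OF b_K] K_subset_M[OF numeral_K]
    by (simp add: galois_add galois_mult galois_K b_K numeral_K power2_eq_square galois_r)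
  also have "\<dots> = 1" using deriv_nonzero galois_K[OF one_K] by simp
  finally have nz: "3 * r'\<^sup>2 + b \<noteq> 0" by auto
  have "(2 * r' + r) * (3 * r\<^sup>2 + b) = (- 2 * r - r') * (3 * r'\<^sup>2 + b)"
  proof -
    have "(2 * r' + r) * (3 * r\<^sup>2 + b) =
        (- 2 * r - r') * (3 * r'\<^sup>2 + b) + 3 * (r + r') * (r'\<^sup>2 + r * r' + r\<^sup>2 + b)"
          by (simp add: power2_eq_square power3_eq_cube algebra_simps)
    then show ?thesis using r'_quadratic by simp
  qed
  with 1 nz have "2 * galois r' + r' = - 2 * r - r'" by simp
  then have "2 * galois r' = 2 * (- r - r')" by (simp add: algebra_simps eq_diff_eq)
  then show ?thesis by (metis mult_left_cancel zero_neq_numeral)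
qed

lemma galois_third_root: "galois (- r - r') = r"
proof -
  have "- r - r' = (-1) * (r + r')" by simp
  moreover have "- 1 \<in> K" using closed_K by blast
  ultimately have "galois (- r - r') = (-1) * (galois r + galois r')"
    using r_M r'_M M.closed_K K_subset_M galois_K by (metis galois_add galois_mult)
  then show ?thesis by (simp add: galois_r galois_r')
qed

lemma galois_combination:
  assumes "a0 \<in> K" "a1 \<in> K" "a2 \<in> K" "y \<in> M"
  shows "galois (a0 + a1 * y + a2 * y\<^sup>2) = a0 + a1 * galois y + a2 * (galois y)\<^sup>2"
  using assms K_subset_M M.closed_K
  by (simp add: galois_add galois_mult galois_K power2_eq_square)

lemma galois_order: "x \<in> M \<Longrightarrow> galois (galois (galois x)) = x"
proof (elim M_cases)
  fix a0 a1 a2 assume "a0 \<in> K" "a1 \<in> K" "a2 \<in> K" "x = a0 + a1 * r + a2 * r\<^sup>2"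
  then show ?thesis
    using r_M r'_M M.closed_K by (simp add: galois_combination galois_r galois_r' galois_third_root)
qed

lemma trace_K: "x \<in> M \<Longrightarrow> x + galois x + galois (galois x) \<in> K"
proof (elim M_cases)
  fix a0 a1 a2 assume a: "a0 \<in> K" "a1 \<in> K" "a2 \<in> K" "x = a0 + a1 * r + a2 * r\<^sup>2"
  then have "x + galois x + galois (galois x) =
      (a0 + a1 * r + a2 * r\<^sup>2) + (a0 + a1 * r' + a2 * r'\<^sup>2) + (a0 + a1 * (- r - r') + a2 * (- r - r')\<^sup>2)"
    using r_M r'_M by (simp add: galois_combination galois_r galois_r')
  also have "\<dots> = (3 * a0 - 2 * b * a2) + 2 * a2 * (r'\<^sup>2 + r * r' + r\<^sup>2 + b)"
    by (simp add: power2_eq_square power3_eq_cube algebra_simps)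
  also have "\<dots> = 3 * a0 - 2 * b * a2" using r'_quadratic by simp
  also have "\<dots> \<in> K" using a b_K by (intro closed_K)
  finally show ?thesis .
qed

lemma algebraic_int_galois:
  assumes "x \<in> M" "algebraic_int x"
  shows "algebraic_int (galois x)"
proof -
  obtain p where p: "poly (map_poly of_int p) x = 0" "Polynomial.lead_coeff p = 1"
    using assms algebraic_int_altdef_ipoly by blast
  have int_K: "of_int k \<in> K" for k
  proof -
    have "of_nat m \<in> K" for m by (induction m) (auto intro: closed_K)
    then show ?thesis by (cases k rule: int_cases2) (auto intro: minus_K)
  qed
  have "poly (map_poly of_int f) x \<in> M \<and>
      galois (poly (map_poly of_int f) x) = poly (map_poly of_int f) (galois x)" for f
  proof (induction f)
    case 0
    then show ?case using M.zero_K galois_K[OF zero_K] by simp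
  next
    case (pCons a f)
    then show ?case
      using assms(1) K_subset_M[OF int_K[of a]] M.closed_K
      by (simp add: of_int_hom.map_poly_pCons_hom galois_add galois_mult galois_K int_K)
  qed
  then have "poly (map_poly of_int p) (galois x) = 0" using p(1) galois_K[OF zero_K] by metis
  then show ?thesis using p(2) algebraic_int_altdef_ipoly by blast
qed

end

section \<open>Number fields and adjunction of roots\<close>

interpretation ambient: domain "ambient :: 'a::field_char_0 ring"
  by (rule field.axioms(1)[OF field_from_type_algebra])

lemma ambient_simps [simp]:
  "carrier ambient = UNIV" "x \<otimes>\<^bsub>ambient\<^esub> y = x * y" "x \<oplus>\<^bsub>ambient\<^esub> y = x + y"
  "\<one>\<^bsub>ambient\<^esub> = 1" "\<zero>\<^bsub>ambient\<^esub> = 0"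
  by (simp_all add: ring_of_type_algebra_def)

lemma a_inv_ambient [simp]: "a_inv ambient x = - (x :: 'a::field_char_0)"
  using ambient.minus_equality[of "- x" x] by simp

lemma m_inv_ambient [simp]: "x \<noteq> 0 \<Longrightarrow> m_inv ambient x = inverse (x :: 'a::field_char_0)"
  using ambient.comm_inv_char[of x "inverse x"] by simp

lemma subfield_imp_set_field:
  fixes K :: "'a::field_char_0 set"
  assumes K: "subfield K ambient"
  shows "set_field K"
proof
  note subring = subringE[OF subfieldE(1)[OF K], simplified]
  show "1 \<in> K" using subring by simp
  show "x + y \<in> K" "x * y \<in> K" if "x \<in> K" "y \<in> K" for x y
    using subring that by auto
  show "- x \<in> K" if "x \<in> K" for x using subring that by auto
  show "inverse x \<in> K" if "x \<in> K" for x
    using subring ambient.subfield_m_inv(1)[OF K, of x] that by (cases "x = 0") auto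
qed

lemma subfield_Rats: "subfield \<rat> (ambient :: 'a::field_char_0 ring)"
proof (rule field.subfieldI'[OF field_from_type_algebra])
  show "subring \<rat> (ambient :: 'a ring)"
    by (rule ambient.subringI) auto
  show "m_inv ambient k \<in> \<rat>" if "k \<in> \<rat> - {\<zero>\<^bsub>ambient\<^esub>}" for k :: 'a
    using that by (auto intro: Rats_inverse)
qed

lemma Span_subset_rat_span:
  fixes Us :: "'a::field_char_0 list"
  shows "ambient.Span \<rat> Us \<subseteq> rat_span.span (set Us)"
proof (induction Us)
  case Nil
  then show ?case by (auto simp: rat_span.span_zero)
next
  case (Cons u Us)
  show ?case
  proof
    fix x assume "x \<in> ambient.Span \<rat> (u # Us)"
    then obtain k v where kv: "k \<in> \<rat>" "v \<in> ambient.Span \<rat> Us" "x = k * u + v"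
      by (auto simp: ambient.line_extension_mem_iff)
    have "v \<in> rat_span.span (set (u # Us))"
      using kv(2) Cons.IH rat_span.span_mono[of "set Us" "set (u # Us)"] by auto
    moreover have "k * u \<in> rat_span.span (set (u # Us))"
      using kv(1) by (auto elim!: Rats_cases intro: rat_span.span_scale rat_span.span_base)
    ultimately show "x \<in> rat_span.span (set (u # Us))"
      unfolding kv(3) by (rule rat_span.span_add[rotated])
  qed
qed

lemma number_field_finite_rank:
  fixes M :: "'a::field_char_0 set"
  assumes "number_field M"
  shows "\<exists>B. finite B \<and> M \<subseteq> rat_span.span B"
proof -
  obtain n where n: "ambient.dimension n \<rat> M"
    using assms unfolding number_field_def ambient.finite_dimension_def by blast
  obtain Us where "ambient.Span \<rat> Us = M"
    using ambient.exists_base[OF subfield_Rats n] by blast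
  then show ?thesis using Span_subset_rat_span by blast
qed

lemma adjoin_root:
  fixes F :: "'a::field_char_0 set"
  assumes F: "number_field F" and p: "p \<in> carrier (F[X]\<^bsub>ambient\<^esub>)" "p \<noteq> []" "ambient.eval p x = 0"
  shows "adjoin F {x} = ambient.simple_extension F x" "number_field (adjoin F {x})"
proof -
  have sub: "subfield F ambient" using F by (simp add: number_field_def)
  have alg: "(ambient.algebraic over F) x"
    using ambient.algebraicI[OF p(1,2)] p(3) by (simp add: over_def)
  have sub': "subfield (ambient.simple_extension F x) ambient"
    using ambient.simple_extension_is_subfield[OF sub] alg by simp
  show eq: "adjoin F {x} = ambient.simple_extension F x"
    unfolding adjoin_def
  proof (rule field.generate_fieldI[OF field_from_type_algebra, symmetric])
    show "F \<union> {x} \<subseteq> ambient.simple_extension F x"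
      using ambient.simple_extension_incl[of F x] ambient.simple_extension_mem[OF subfieldE(1)[OF sub], of x]
      by simp
    show "ambient.simple_extension F x \<subseteq> E" if "subfield E ambient" "F \<union> {x} \<subseteq> E" for E
      using ambient.simple_extension_subring_incl[OF subfieldE(1)[OF that(1)]] that(2) by simp
  qed (use sub' in auto)
  have "ambient.finite_dimension F (ambient.simple_extension F x)"
    using ambient.finite_dimension_simple_extension[OF sub] alg by simp
  then obtain m where "ambient.dimension m F (ambient.simple_extension F x)"
    by (auto simp: ambient.finite_dimension_def)
  moreover obtain n where "ambient.dimension n \<rat> F"
    using F unfolding number_field_def ambient.finite_dimension_def by blast
  ultimately have "ambient.dimension (n * m) \<rat> (ambient.simple_extension F x)"
    using ambient.telescopic_base[OF subfield_Rats sub] by blast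
  then show "number_field (adjoin F {x})"
    unfolding eq number_field_def ambient.finite_dimension_def using sub' by blast
qed

lemma adjoin_insert:
  fixes F :: "'a::field_char_0 set"
  shows "adjoin F {r, s} = adjoin (adjoin F {s}) {r}"
proof
  have sub: "subfield (adjoin F S) ambient" for F S :: "'a set"
    unfolding adjoin_def by (rule field.generate_field_is_subfield[OF field_from_type_algebra]) simp
  have incl: "F \<union> S \<subseteq> adjoin F S" for F S :: "'a set"
    unfolding adjoin_def by (auto intro: generate_field.incl)
  have min: "adjoin F S \<subseteq> E" if "subfield E ambient" "F \<union> S \<subseteq> E" for F S E :: "'a set"
    unfolding adjoin_def using field.generate_field_min_subfield1[OF field_from_type_algebra _ that] by simp
  show "adjoin F {r, s} \<subseteq> adjoin (adjoin F {s}) {r}"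
    using incl[of F "{s}"] incl[of "adjoin F {s}" "{r}"] by (intro min sub) auto
  show "adjoin (adjoin F {s}) {r} \<subseteq> adjoin F {r, s}"
    using incl[of F "{r, s}"] min[OF sub, of F "{s}" F "{r, s}"] by (intro min sub) auto
qed

lemma irreducible_cubic_no_root:
  fixes F :: "'a::field_char_0 set"
  assumes F: "subfield F ambient" and irr: "irreducible_over F [1, 0, b, q]" and x: "x \<in> F"
  shows "x ^ 3 + b * x + q \<noteq> 0"
proof
  assume root: "x ^ 3 + b * x + q = 0"
  interpret F: set_field F using F by (rule subfield_imp_set_field)
  have carrier: "[1, 0, b, q] \<in> carrier (F[X]\<^bsub>ambient\<^esub>)"
    and pirr: "pirreducible\<^bsub>ambient\<^esub> F [1, 0, b, q]"
    using irr by (auto simp: irreducible_over_def)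
  have "b \<in> F" using carrier by (auto simp: univ_poly_def polynomial_def)
  then have fac: "[1, - x] \<in> carrier (F[X]\<^bsub>ambient\<^esub>)" "[1, x, x\<^sup>2 + b] \<in> carrier (F[X]\<^bsub>ambient\<^esub>)"
    using x F.closed_K by (auto simp: univ_poly_def polynomial_def)
  have q: "q = - (x * (x\<^sup>2 + b))"
    using root by (simp add: power2_eq_square power3_eq_cube algebra_simps eq_neg_iff_add_eq_0)
  have "[1, 0, b, q] = [1, - x] \<otimes>\<^bsub>F[X]\<^bsub>ambient\<^esub>\<^esub> [1, x, x\<^sup>2 + b]"
    by (simp add: univ_poly_mult q power2_eq_square)
  then show False
    using ambient.pirreducibleE(3)[OF subfieldE(1)[OF F] carrier pirr fac]
      ambient.univ_poly_units[OF F] by auto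
qed

section \<open>Primes and ramification indices in number fields\<close>

lemma integer_prime_if_primeideal:
  fixes M :: "'a::field_char_0 set"
  assumes M: "number_field M" and P: "primeideal P (integer_ring M)" "P \<noteq> {0}"
  shows "integer_prime (ring_of_integers M) P"
proof -
  interpret P: primeideal P "integer_ring M" by fact
  have simps: "carrier (integer_ring M) = ring_of_integers M" "x \<otimes>\<^bsub>integer_ring M\<^esub> y = x * y"
    "x \<oplus>\<^bsub>integer_ring M\<^esub> y = x + y" "\<one>\<^bsub>integer_ring M\<^esub> = 1" "\<zero>\<^bsub>integer_ring M\<^esub> = 0" for x y
    by (simp_all add: integer_ring_def)
  show ?thesis
  proof
    show "1 \<in> ring_of_integers M" using P.one_closed by (simp add: simps)
    show "x + y \<in> ring_of_integers M" "x * y \<in> ring_of_integers M"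
      if "x \<in> ring_of_integers M" "y \<in> ring_of_integers M" for x y
      using P.add.m_closed[of x y] P.m_closed[of x y] that by (simp_all add: simps)
    show "- x \<in> ring_of_integers M" if x: "x \<in> ring_of_integers M" for x
    proof -
      have "set_field M" using M subfield_imp_set_field by (auto simp: number_field_def)
      then show ?thesis using x set_field.minus_K by (auto simp: ring_of_integers_def)
    qed
    show "algebraic_int x" if "x \<in> ring_of_integers M" for x
      using that by (simp add: ring_of_integers_def)
    show "\<exists>B. finite B \<and> ring_of_integers M \<subseteq> rat_span.span B"
      using number_field_finite_rank[OF M] by (force simp: ring_of_integers_def)
    show "x \<in> ring_of_integers M" if "x \<in> P" for x using P.Icarr[OF that] by (simp add: simps)
    show "x + y \<in> P" if "x \<in> P" "y \<in> P" for x y using additive_subgroup.a_closed[OF ideal.axioms(1)[OF P.is_ideal] that] by (simp add: simps)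
    show "a * x \<in> P" if "a \<in> ring_of_integers M" "x \<in> P" for a x
      using P.I_l_closed[of x a] that by (simp add: simps)
    show "1 \<notin> P" using P.one_imp_carrier P.I_notcarr by (auto simp: simps)
    show "a \<in> P \<or> b \<in> P" if "a \<in> ring_of_integers M" "b \<in> ring_of_integers M" "a * b \<in> P" for a b
      using P.I_prime[of a b] that by (simp add: simps)
    show "\<exists>x\<in>P. x \<noteq> 0" using additive_subgroup.zero_closed[OF ideal.axioms(1)[OF P.is_ideal]] P(2) by (auto simp: simps)
  qed
qed

text \<open>As \<open>P\<^sup>n\<close> is contained in \<open>P\<^sup>2\<close> for \<open>n \<ge> 2\<close>, one element of the
  prime below that avoids \<open>P\<^sup>2\<close> is enough.\<close>

lemma ramification_index_eq_1:
  fixes K M :: "'a::field_char_0 set"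
  assumes P: "primeideal P (integer_ring M)"
    and KM: "ring_of_integers K \<subseteq> ring_of_integers M"
    and x: "x \<in> P" "x \<in> ring_of_integers K" "x \<notin> ideal_prod (integer_ring M) P P"
  shows "ramification_index K M P = 1"
proof -
  interpret P: primeideal P "integer_ring M" by fact
  interpret I: comm_monoid "ideals_set (integer_ring M)" by (rule P.ideals_set_is_comm_monoid)
  have PI: "P \<in> carrier (ideals_set (integer_ring M))"
    using P.is_ideal by (simp add: ideals_set_def)
  have mult: "monoid.mult (ideals_set (integer_ring M)) = ideal_prod (integer_ring M)"
    by (simp add: ideals_set_def)
  let ?S = "P \<inter> ring_of_integers K"
  have self: "?S \<subseteq> Idl\<^bsub>integer_ring M\<^esub> ?S"
    using KM by (intro P.genideal_self) (auto simp: integer_ring_def)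
  show ?thesis
    unfolding ramification_index_def
  proof (rule Greatest_equality)
    have "P [^]\<^bsub>ideals_set (integer_ring M)\<^esub> (1::nat) = P"
      using PI by simp
    then show "Idl\<^bsub>integer_ring M\<^esub> ?S \<subseteq> P [^]\<^bsub>ideals_set (integer_ring M)\<^esub> (1::nat)"
      using P.genideal_minimal[OF P.is_ideal, of ?S] by simp
  next
    fix n :: nat
    assume n: "Idl\<^bsub>integer_ring M\<^esub> ?S \<subseteq> P [^]\<^bsub>ideals_set (integer_ring M)\<^esub> n"
    show "n \<le> 1"
    proof (rule ccontr)
      assume "\<not> n \<le> 1"
      then obtain m where m: "n = Suc (Suc m)" by (metis One_nat_def Suc_le_D not_less_eq_eq)
      let ?Q = "P [^]\<^bsub>ideals_set (integer_ring M)\<^esub> m"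
      have "?Q \<in> carrier (ideals_set (integer_ring M))" using PI by simp
      then have Q: "ideal ?Q (integer_ring M)" by (simp add: ideals_set_def)
      have "P [^]\<^bsub>ideals_set (integer_ring M)\<^esub> n = ideal_prod (integer_ring M) ?Q (ideal_prod (integer_ring M) P P)"
        using PI I.m_assoc[of ?Q P P] by (simp add: m mult)
      also have "\<dots> \<subseteq> ideal_prod (integer_ring M) P P"
        using P.ideal_prod_inter[OF Q P.ideal_prod_is_ideal[OF P.is_ideal P.is_ideal]] by blast
      finally show False using x self n by blast
    qed
  qed
qed

section \<open>Real cubics\<close>

text \<open>With a root \<open>x + i * y\<close> that is not real, the other roots are \<open>x - i * y\<close> and
  \<open>- 2 * x\<close>, and the discriminant is \<open>- 4 * y\<^sup>2 * (9 * x\<^sup>2 + y\<^sup>2)\<^sup>2\<close>, which is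
  negative.\<close>

lemma real_cubic_roots:
  fixes z :: complex
  assumes "\<beta> \<in> \<real>" "\<gamma> \<in> \<real>" "\<delta> \<in> \<real>"
    and root: "z ^ 3 + \<beta> * z + \<gamma> = 0" and disc: "\<delta>\<^sup>2 = - 4 * \<beta> ^ 3 - 27 * \<gamma>\<^sup>2"
  shows "z \<in> \<real>"
proof (rule ccontr)
  assume "z \<notin> \<real>"
  obtain B C D where BCD: "\<beta> = of_real B" "\<gamma> = of_real C" "\<delta> = of_real D"
    using assms(1-3) by (auto elim!: Reals_cases)
  define x where "x = Re z"
  define y where "y = Im z"
  have y: "y \<noteq> 0" using \<open>z \<notin> \<real>\<close> by (auto simp: y_def complex_is_Real_iff)
  have z: "z = Complex x y" by (simp add: x_def y_def)
  have "Im (z ^ 3 + \<beta> * z + \<gamma>) = y * (3 * x\<^sup>2 - y\<^sup>2 + B)"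
    by (simp add: z BCD power3_eq_cube power2_eq_square algebra_simps)
  then have "y * (3 * x\<^sup>2 - y\<^sup>2 + B) = 0" by (simp only: root zero_complex.sel)
  then have B: "B = y\<^sup>2 - 3 * x\<^sup>2" using y by simp
  have "Re (z ^ 3 + \<beta> * z + \<gamma>) = x ^ 3 - 3 * x * y\<^sup>2 + B * x + C"
    by (simp add: z BCD power3_eq_cube power2_eq_square algebra_simps)
  then have "x ^ 3 - 3 * x * y\<^sup>2 + B * x + C = 0" by (simp only: root zero_complex.sel)
  then have C: "C = 2 * x * y\<^sup>2 + 2 * x ^ 3"
    by (simp add: B power3_eq_cube power2_eq_square algebra_simps)
  have "complex_of_real (D\<^sup>2) = complex_of_real (- 4 * B ^ 3 - 27 * C\<^sup>2)"
    using disc by (simp add: BCD)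
  then have "D\<^sup>2 = - 4 * B ^ 3 - 27 * C\<^sup>2" by (simp only: of_real_eq_iff)
  also have "\<dots> = - (4 * y\<^sup>2 * (9 * x\<^sup>2 + y\<^sup>2)\<^sup>2)"
    unfolding B C by (simp add: power3_eq_cube power2_eq_square algebra_simps)
  also have "\<dots> < 0"
  proof -
    have "9 * x\<^sup>2 + y\<^sup>2 > 0" using y by (intro add_nonneg_pos) auto
    then show ?thesis using y by (simp del: power2_eq_square)
  qed
  finally show False by simp
qed

section \<open>Generators of the quadratic and the cubic extension\<close>

lemma simple_extension_quadratic:
  fixes F :: "'a::field_char_0 set"
  assumes F: "subfield F ambient" and s: "s\<^sup>2 \<in> F" and x: "x \<in> ambient.simple_extension F s"
  shows "\<exists>a\<in>F. \<exists>c\<in>F. x = a + c * s"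
proof -
  interpret F: set_field F using F by (rule subfield_imp_set_field)
  show ?thesis
    using x
  proof (induction rule: ambient.simple_extension.induct)
    case zero
    then show ?case using F.zero_K by force
  next
    case (lin x k)
    then obtain a c where ac: "a \<in> F" "c \<in> F" "x = a + c * s" by blast
    have "x * s + k = (c * s\<^sup>2 + k) + a * s" by (simp add: ac power2_eq_square algebra_simps)
    moreover have "c * s\<^sup>2 + k \<in> F" using ac s lin(2) by (intro F.add_K F.mult_K)
    ultimately show ?case unfolding ambient_simps using ac(1) by blast
  qed
qed

lemma simple_extension_cubic:
  fixes K :: "'a::field_char_0 set"
  assumes K: "subfield K ambient" and bq: "b \<in> K" "q \<in> K" and r: "r ^ 3 + b * r + q = 0"
    and x: "x \<in> ambient.simple_extension K r"
  shows "\<exists>a0\<in>K. \<exists>a1\<in>K. \<exists>a2\<in>K. x = a0 + a1 * r + a2 * r\<^sup>2"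
proof -
  interpret K: set_field K using K by (rule subfield_imp_set_field)
  show ?thesis
    using x
  proof (induction rule: ambient.simple_extension.induct)
    case zero
    then show ?case using K.zero_K by force
  next
    case (lin x k)
    then obtain a0 a1 a2 where a: "a0 \<in> K" "a1 \<in> K" "a2 \<in> K" "x = a0 + a1 * r + a2 * r\<^sup>2" by blast
    have "x * r + k = (k - q * a2) + (a0 - b * a2) * r + a1 * r\<^sup>2 + a2 * (r ^ 3 + b * r + q)"
      by (simp add: a power2_eq_square power3_eq_cube algebra_simps)
    then have "x * r + k = (k - q * a2) + (a0 - b * a2) * r + a1 * r\<^sup>2" by (simp add: r)
    moreover have "k - q * a2 \<in> K" "a0 - b * a2 \<in> K" using a(1-3) bq lin(2) K.diff_K K.mult_K by auto
    ultimately show ?case unfolding ambient_simps using a(2) by blast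
  qed
qed

section \<open>The unramified extension\<close>

text \<open>The multiple \<open>k * r\<close> is a root of \<open>x\<^sup>3 + k\<^sup>2 * b * x + k\<^sup>3 * q\<close>. If its
  conjugates were all congruent modulo \<open>P\<close>, then, as their sum is zero, their second elementary
  symmetric function \<open>k\<^sup>2 * b\<close> would be congruent to \<open>3 * (k * r)\<^sup>2\<close>, which is
  \<open>k * r\<close> times the vanishing sum. So it would lie in \<open>P\<close>.\<close>

lemma (in cubic_extension) ramification_index_above:
  assumes M: "number_field M" and P: "primeideal P (integer_ring M)" "P \<noteq> {0}"
    and k: "k \<in> K" "algebraic_int (k * r)" "k\<^sup>2 * b \<notin> P"
  shows "ramification_index K M P = 1"
proof -
  interpret P: integer_prime "ring_of_integers M" P
    using integer_prime_if_primeideal[OF M P] .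
  define y where "y = k * r"
  have kM: "k \<in> M" using k(1) K_subset_M by blast
  have yM: "y \<in> M" using M.mult_K[OF kM r_M] by (simp add: y_def)
  have y: "y \<in> ring_of_integers M" using yM k(2) by (simp add: ring_of_integers_def y_def)
  have galois_int: "galois x \<in> ring_of_integers M" if "x \<in> ring_of_integers M" for x
    using that galois_M algebraic_int_galois by (auto simp: ring_of_integers_def)
  have in_M: "x \<in> M" if "x \<in> ring_of_integers M" for x using that by (simp add: ring_of_integers_def)
  have y': "galois y = k * r'"
    by (simp add: y_def galois_mult[OF kM r_M] galois_K[OF k(1)] galois_r)
  have y'': "galois (galois y) = k * (- r - r')"
    unfolding y' using galois_mult[OF kM r'_M] galois_K[OF k(1)] galois_r' by simp
  have not_congruent: "\<not> (galois y - y \<in> P \<and> galois (galois y) - y \<in> P)"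
  proof
    assume "galois y - y \<in> P \<and> galois (galois y) - y \<in> P"
    then have 1: "galois y - y \<in> P" and 2: "galois (galois y) - y \<in> P" by auto
    have "k\<^sup>2 * b = (y * ((galois y - y) + (galois (galois y) - y)) -
        (2 * y + galois y) * (galois y - y)) + k\<^sup>2 * (r'\<^sup>2 + r * r' + r\<^sup>2 + b)"
      unfolding y'' unfolding y' unfolding y_def by (simp add: power2_eq_square algebra_simps)
    also have "\<dots> = y * ((galois y - y) + (galois (galois y) - y)) - (y + y + galois y) * (galois y - y)"
      unfolding r'_quadratic by simp
    also have "\<dots> \<in> P"
      by (intro P.diff_P[OF P.mult_P P.mult_P] P.add_P P.add_R 1 2 y galois_int)
    finally show False using k(3) by blast
  qed
  obtain x where x: "x \<in> P" "x + galois x + galois (galois x) \<in> P"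
    "x + galois x + galois (galois x) \<notin> P.square_P"
    using P.trace_notin_square_P[of galois y] galois_int galois_mult galois_K[OF one_K] galois_order in_M y
      not_congruent by blast
  have "x + galois x + galois (galois x) \<in> ring_of_integers K"
    using trace_K[OF in_M[OF P.P_R[OF x(1)]]] P.integral_R[OF P.P_R[OF x(2)]]
    by (simp add: ring_of_integers_def)
  moreover have "ring_of_integers K \<subseteq> ring_of_integers M"
    using K_subset_M by (auto simp: ring_of_integers_def)
  ultimately show ?thesis
    using ramification_index_eq_1[OF P(1), of K "x + galois x + galois (galois x)"] x
    by (simp add: integer_ring_def)
qed

theorem corollary81:
  fixes F :: "'a::field_char_0 set" and b t d r s :: 'a
  assumes "number_field F"
    and "b \<in> ring_of_integers F" and "t \<in> ring_of_integers F"
    and "irreducible_over F [1, 0, b, b^2 * t]"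
    and "r^3 + b * r + b^2 * t = 0"
    and "d = - 27 * b * t^2 - 4"
    and "s^2 = b * d"
  shows "unramified_extension (adjoin F {s}) (adjoin F {r, s})"
proof -
  define q where "q = b\<^sup>2 * t"
  have root: "r ^ 3 + b * r + q = 0" using assms(5) by (simp add: q_def)
  have F: "subfield F ambient" using assms(1) by (simp add: number_field_def)
  interpret F: set_field F using F by (rule subfield_imp_set_field)
  have bt: "b \<in> F" "t \<in> F" "algebraic_int b" "algebraic_int t"
    using assms(2,3) by (auto simp: ring_of_integers_def)
  have no_root: "x ^ 3 + b * x + q \<noteq> 0" if "x \<in> F" for x
    using irreducible_cubic_no_root[OF F assms(4) that] by (simp add: q_def)
  have "b \<noteq> 0" using no_root[OF F.zero_K] by (auto simp: q_def)
  have s2: "s\<^sup>2 \<in> F" unfolding assms(6,7) using bt by (intro F.closed_K)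
  define K where "K = adjoin F {s}"
  have "[1, 0, - s\<^sup>2] \<in> carrier (F[X]\<^bsub>ambient\<^esub>)"
    using s2 F.closed_K by (auto simp: univ_poly_def polynomial_def)
  moreover have "ambient.eval [1, 0, - s\<^sup>2] s = 0" by (simp add: numeral_2_eq_2)
  ultimately have K_eq: "K = ambient.simple_extension F s" and K_nf: "number_field K"
    using adjoin_root[OF assms(1)] unfolding K_def by blast+
  have K: "subfield K ambient" using K_nf by (simp add: number_field_def)
  interpret K: set_field K using K by (rule subfield_imp_set_field)
  have FK: "x \<in> K" if "x \<in> F" for x
    using that by (auto simp: K_def adjoin_def intro: generate_field.incl)
  have sK: "s \<in> K" by (auto simp: K_def adjoin_def intro: generate_field.incl)
  have bq_K: "b \<in> K" "t \<in> K" "q \<in> K" using bt FK K.closed_K by (auto simp: q_def)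
  have no_root_K: "x ^ 3 + b * x + q \<noteq> 0" if x: "x \<in> K" for x
  proof -
    have "q \<in> F" unfolding q_def using bt by (intro F.closed_K)
    moreover obtain a c where "a \<in> F" "c \<in> F" "x = a + c * s"
      using simple_extension_quadratic[OF F s2] x unfolding K_eq by blast
    ultimately show ?thesis
      using F.no_cubic_root_in_quadratic_extension[OF bt(1) _ s2 no_root] by simp
  qed
  define M' where "M' = adjoin K {r}"
  have "[1, 0, b, q] \<in> carrier (K[X]\<^bsub>ambient\<^esub>)"
    using bq_K K.closed_K by (auto simp: univ_poly_def polynomial_def)
  moreover have "ambient.eval [1, 0, b, q] r = 0"
    using root by (simp add: numeral_3_eq_3 numeral_2_eq_2 algebra_simps)
  ultimately have M_eq: "M' = ambient.simple_extension K r" and M_nf: "number_field M'"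
    using adjoin_root[OF K_nf] unfolding M'_def by blast+
  interpret M': set_field M'
    using M_nf by (intro subfield_imp_set_field) (simp add: number_field_def)
  have KM: "x \<in> M'" if "x \<in> K" for x
    using that by (auto simp: M'_def adjoin_def intro: generate_field.incl)
  have rM: "r \<in> M'" by (auto simp: M'_def adjoin_def intro: generate_field.incl)
  interpret cubic_extension K b q r "b * s"
  proof
    show "(b * s)\<^sup>2 = - 4 * b ^ 3 - 27 * q\<^sup>2"
      unfolding power_mult_distrib assms(6,7) q_def
      by (simp add: power2_eq_square power3_eq_cube algebra_simps)
    fix a0 a1 a2 assume a: "a0 \<in> K" "a1 \<in> K" "a2 \<in> K"
    then have "inverse (a0 + a1 * r + a2 * r\<^sup>2) \<in> M'"
      using KM rM by (intro M'.closed_K) auto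
    then show "\<exists>c0\<in>K. \<exists>c1\<in>K. \<exists>c2\<in>K. inverse (a0 + a1 * r + a2 * r\<^sup>2) = c0 + c1 * r + c2 * r\<^sup>2"
      using simple_extension_cubic[OF K bq_K(1,3) root] unfolding M_eq by blast
  qed (use bq_K sK K.closed_K no_root_K root in auto)
  have M_eq': "adjoin F {r, s} = M"
  proof -
    have "M' = M"
    proof
      show "M' \<subseteq> M"
        using simple_extension_cubic[OF K bq_K(1,3) root] unfolding M_eq M_def by blast
      show "M \<subseteq> M'" using KM rM by (auto elim!: M_cases intro!: M'.closed_K)
    qed
    then show ?thesis using adjoin_insert[of F r s] by (simp add: M'_def K_def)
  qed
  have M: "number_field M"
    using M_nf M_eq' adjoin_insert[of F r s] by (simp add: M'_def K_def)
  have "unramified_at_finite_places K M"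
    unfolding unramified_at_finite_places_def
  proof (intro allI impI, elim conjE)
    fix P assume P: "primeideal P (integer_ring M)" "P \<noteq> {0}"
    interpret P: integer_prime "ring_of_integers M" P
      using integer_prime_if_primeideal[OF M P] .
    have bt_R: "b \<in> ring_of_integers M" "t \<in> ring_of_integers M"
      using bt bq_K K_subset_M by (auto simp: ring_of_integers_def)
    show "ramification_index K M P = 1"
    proof (cases "b \<in> P")
      case False
      have "algebraic_int q"
        unfolding q_def power2_eq_square using bt_R by (intro P.integral_R P.mult_R)
      then have "algebraic_int r"
        using algebraic_int_depressed_cubic[OF bt(3) _ root] by blast
      then show ?thesis
        using ramification_index_above[OF M P K.one_K] False by simp
    next
      case True
      \<comment> \<open>Modulo \<open>P\<close> the cubic degenerates to \<open>x\<^sup>3\<close>, so \<open>r\<close> has to be rescaled. The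
        integer \<open>w\<close> of \<open>K\<close> has square \<open>b\<close> times an element \<open>u\<close> congruent to
        \<open>- 1\<close> modulo \<open>P\<close>, and \<open>w / b * r\<close> is a root of
        \<open>x\<^sup>3 + u * x + t * w * u\<close>.\<close>
      define w where "w = (b * t - s) / 2"
      define u where "u = t * w - (1 + 7 * b * t\<^sup>2)"
      have wK: "w \<in> K" unfolding w_def using bq_K sK by (intro K.closed_K)
      have w2: "w\<^sup>2 = b * u"
      proof -
        have s: "s = b * t - 2 * w" by (simp add: w_def field_simps)
        have "4 * (w\<^sup>2 - b * u) = s\<^sup>2 + 27 * b\<^sup>2 * t\<^sup>2 + 4 * b"
          unfolding s u_def by (simp add: power2_eq_square algebra_simps)
        also have "\<dots> = 0"
          unfolding assms(6,7) by (simp add: power2_eq_square algebra_simps)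
        finally show ?thesis by (simp only: mult_eq_0_iff zero_neq_numeral[symmetric] simp_thms
              eq_iff_diff_eq_0[of "w\<^sup>2"])
      qed
      have seven: "1 + 7 * b * t\<^sup>2 \<in> ring_of_integers M"
        using P.add_R[OF P.one_R P.mult_R[OF P.mult_R[OF P.of_int_R[of 7] bt_R(1)] P.mult_R[OF bt_R(2) bt_R(2)]]]
        by (simp add: power2_eq_square)
      have "algebraic_int w"
      proof (rule algebraic_int_monic_quadratic)
        show "w\<^sup>2 + (- (b * t)) * w + b * (1 + 7 * b * t\<^sup>2) = 0"
          unfolding w2 u_def by (simp add: algebra_simps)
        show "algebraic_int (- (b * t))" "algebraic_int (b * (1 + 7 * b * t\<^sup>2))"
          using P.integral_R[OF P.minus_R[OF P.mult_R[OF bt_R]]] P.integral_R[OF P.mult_R[OF bt_R(1) seven]]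
          by simp_all
      qed
      then have w_R: "w \<in> ring_of_integers M"
        using wK K_subset_M by (auto simp: ring_of_integers_def)
      have u_R: "u \<in> ring_of_integers M"
        unfolding u_def using bt_R w_R seven by (intro P.diff_R P.mult_R)
      have "w \<in> P"
      proof -
        have "w * w \<in> P"
          using w2 P.mult_P[OF u_R True] by (simp add: power2_eq_square mult.commute)
        then show ?thesis using P.prime_P w_R by blast
      qed
      have "u \<notin> P"
      proof
        assume "u \<in> P"
        have "7 * t\<^sup>2 \<in> ring_of_integers M"
          using P.mult_R[OF P.of_int_R[of 7] P.mult_R[OF bt_R(2) bt_R(2)]] by (simp add: power2_eq_square)
        then have "t * w - (7 * t\<^sup>2) * b - u \<in> P"
          using \<open>w \<in> P\<close> \<open>u \<in> P\<close> True bt_R by (intro P.diff_P P.mult_P)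
        then show False using P.one_notin_P by (simp add: u_def algebra_simps)
      qed
      moreover have "(w / b)\<^sup>2 * b = u"
        using w2 \<open>b \<noteq> 0\<close> by (simp add: power_divide power2_eq_square)
      moreover have "algebraic_int (w / b * r)"
      proof (rule algebraic_int_depressed_cubic)
        have "(w / b * r) ^ 3 + u * (w / b * r) + t * w * u = (w * u / b\<^sup>2) * (r ^ 3 + b * r + q)"
        proof -
          have "w ^ 3 = b * u * w" using w2 by (simp add: power3_eq_cube power2_eq_square)
          moreover have "(w / b * r) ^ 3 = w ^ 3 * r ^ 3 / b ^ 3"
            by (simp add: power_mult_distrib power_divide)
          ultimately have "(w / b * r) ^ 3 = b * u * w * r ^ 3 / b ^ 3" by simp
          also have "\<dots> = (w * u / b\<^sup>2) * r ^ 3"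
            using \<open>b \<noteq> 0\<close> by (simp add: power2_eq_square power3_eq_cube)
          finally have "(w / b * r) ^ 3 = (w * u / b\<^sup>2) * r ^ 3" .
          then show ?thesis
            using \<open>b \<noteq> 0\<close> by (simp add: q_def power2_eq_square field_simps)
        qed
        then show "(w / b * r) ^ 3 + u * (w / b * r) + t * w * u = 0" by (simp add: root)
        show "algebraic_int u" "algebraic_int (t * w * u)"
          using P.integral_R[OF u_R] P.integral_R[OF P.mult_R[OF P.mult_R[OF bt_R(2) w_R] u_R]]
          by simp_all
      qed
      ultimately show ?thesis
        using ramification_index_above[OF M P, of "w / b"] wK bq_K K.closed_K by simp
    qed
  qed
  moreover have "unramified_at_infinite_places K M"
    unfolding unramified_at_infinite_places_def
  proof (intro ballI notI, elim conjE)
    fix \<tau> assume \<tau>: "\<tau> \<in> complex_embeddings M" and real: "real_on K \<tau>" and "\<not> real_on M \<tau>"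
    have hom: "\<tau> (x + y) = \<tau> x + \<tau> y" "\<tau> (x * y) = \<tau> x * \<tau> y" if "x \<in> M" "y \<in> M" for x y
      using Ring.ring_hom_add[OF \<tau>[unfolded complex_embeddings_def], of x y]
        Ring.ring_hom_mult[OF \<tau>[unfolded complex_embeddings_def], of x y] that by auto
    have real_K: "\<tau> x \<in> \<real>" if "x \<in> K" for x using real that by (auto simp: real_on_def)
    have \<tau>0: "\<tau> 0 = 0" using hom(1)[of 0 0] M.zero_K by simp
    have \<tau>1: "\<tau> 1 = 1" using Ring.ring_hom_one[OF \<tau>[unfolded complex_embeddings_def]] by simp
    have \<tau>_nat: "\<tau> (of_nat n) = of_nat n \<and> of_nat n \<in> M" for n
      by (induction n) (use hom(1) \<tau>0 \<tau>1 M.closed_K in auto)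
    have \<tau>_num: "\<tau> (numeral n) = numeral n" for n
      using \<tau>_nat[of "numeral n"] by simp
    have \<tau>_minus: "\<tau> (- x) = - \<tau> x" if "x \<in> M" for x
      using hom(1)[OF that M.minus_K[OF that]] \<tau>0 by (simp add: eq_neg_iff_add_eq_0 add.commute)
    have bM: "b \<in> M" "q \<in> M" "s \<in> M" using bq_K sK K_subset_M by auto
    have "\<tau> (r * r * r + b * r + q) = \<tau> 0"
      using root by (simp add: power3_eq_cube)
    then have 1: "\<tau> r ^ 3 + \<tau> b * \<tau> r + \<tau> q = 0"
      using hom \<tau>0 r_M bM M.closed_K by (simp add: power3_eq_cube)
    have "(b * s) * (b * s) + 4 * (b * b * b) + 27 * (q * q) = 0"
      using discriminant by (simp add: power2_eq_square power3_eq_cube)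
    then have "\<tau> ((b * s) * (b * s) + 4 * (b * b * b) + 27 * (q * q)) = 0" using \<tau>0 by simp
    then have "\<tau> (b * s) * \<tau> (b * s) + 4 * (\<tau> b * \<tau> b * \<tau> b) + 27 * (\<tau> q * \<tau> q) = 0"
      using hom \<tau>_num bM M.closed_K by simp
    then have 2: "(\<tau> (b * s))\<^sup>2 = - 4 * \<tau> b ^ 3 - 27 * (\<tau> q)\<^sup>2"
      by (simp add: power2_eq_square power3_eq_cube algebra_simps eq_neg_iff_add_eq_0)
    have "\<tau> r \<in> \<real>"
      using real_cubic_roots[OF _ _ _ 1 2] real_K bq_K \<delta>_K by blast
    then have "\<tau> x \<in> \<real>" if x: "x \<in> M" for x
    proof -
      obtain a0 a1 a2 where a: "a0 \<in> K" "a1 \<in> K" "a2 \<in> K" "x = a0 + a1 * r + a2 * r\<^sup>2"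
        using x M_cases by blast
      then have "\<tau> x = \<tau> a0 + \<tau> a1 * \<tau> r + \<tau> a2 * (\<tau> r * \<tau> r)"
        using hom K_subset_M r_M M.closed_K by (simp add: power2_eq_square)
      then show ?thesis using real_K a \<open>\<tau> r \<in> \<real>\<close> by simp
    qed
    then show False using \<open>\<not> real_on M \<tau>\<close> by (auto simp: real_on_def)
  qed
  moreover have "K \<subseteq> M" using K_subset_M by blast
  ultimately show ?thesis
    using K_nf M by (simp add: unramified_extension_def M_eq' K_def)
qed

end
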